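(* Let $G$ be a connected non-compact Lie group, and let $d$ and $\lambda$ be the distance function and the measure canonically induced by a left-invariant Riemannian metric on $G$ (so $d$ is left-invariant and $\lambda$ is a left Haar measure). Let $w$ be a radius-weight with finite $G$-norm $\|w\|_G<\infty$. Then for all $f\in\mathcal{F}_{loc}(G)$ and all $1\le p\le q\le\infty$, $$\|I_{p,w}f\|_{\mathcal{L}_q(G)}\le\|w\|^{\frac{q-p}{qp}}\,\|w\|_G^{\frac1q}\,\|f\|_{\mathcal{L}_q(G)},$$ where by convention $\frac{\infty-p}{\infty p}=\frac1p$ and $\frac1\infty=0$.
   Context: $\mathcal{B}_{x,r}$ denotes the open $d$-ball with center $x$ and radius $r>0$; $e$ is the identity of $G$; $\mathcal{L}_q(G)=\mathcal{L}_q(G,\lambda)$ (norms may be $+\infty$). $\mathcal{F}_{loc}(G)$ is the set of measurable real-valued functions $f$ on $G$ with $\int_U|f|\,d\lambda<\infty$ for every bounded Borel set $U$ (equivalently, locally integrable functions). For $f\in\mathcal{F}_{loc}(G)$, $Af(x,r):=\frac{1}{\lambda(\mathcal{B}_{x,r})}\int_{\mathcal{B}_{x,r}}|f|\,d\lambda$. A radius-weight is a nonnegative measurable function $w$ on $(0,\infty)$ with $\|w\|:=\int_0^\infty w(r)\,dr<\infty$ and $w\ne0$ almost everywhere. $I_{p,w}f(x):=\big(\int_0^\infty w(r)(Af(x,r))^p\,dr\big)^{1/p}$ for $1\le p<\infty$, and $I_{\infty,w}f(x)$ is the $\mathcal{L}_\infty$-norm of $r\mapsto Af(x,r)$ with respect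 to the measure $w(r)\,dr$, which equals $\sup_{r>0}Af(x,r)$. The modular function $\Delta:G\to(0,\infty)$ is the unique function with $\lambda(Bx)=\Delta(x)\lambda(B)$ for all $x\in G$ and Borel $B\subseteq G$. The $G$-norm of $w$ is $$\|w\|_G:=\int_0^\infty\frac{w(r)}{\lambda(\mathcal{B}_{e,r})}\Big(\int_{\mathcal{B}_{e,r}}\Delta(y^{-1})\,d\lambda(y)\Big)dr.$$ *)

theory Defs
  imports "HOL-Analysis.Analysis" "HOL-Probability.Essential_Supremum"
begin

section \<open>Smooth maps between open subsets of Euclidean spaces\<close>

text \<open>Both notions below are meant for open \<open>S\<close> only.\<close>

primrec Ck_on :: "nat \<Rightarrow> ('a::euclidean_space \<Rightarrow> 'b::euclidean_space) \<Rightarrow> 'a set \<Rightarrow> bool" where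
  "Ck_on 0 = (\<lambda>f S. continuous_on S f)"
| "Ck_on (Suc k) = (\<lambda>f S. (\<forall>x\<in>S. f differentiable (at x)) \<and>
      (\<forall>v. Ck_on k (\<lambda>x. frechet_derivative f (at x) v) S))"

definition smooth_on :: "('a::euclidean_space \<Rightarrow> 'b::euclidean_space) \<Rightarrow> 'a set \<Rightarrow> bool" where
  "smooth_on f S \<longleftrightarrow> (\<forall>k. Ck_on k f S)"


section \<open>Smooth structures and Lie groups\<close>

text \<open>A chart is a pair \<open>(U, \<phi>)\<close>; the values of \<open>\<phi>\<close> outside \<open>U\<close> are irrelevant.\<close>

type_synonym ('g, 'n) chart = "'g set \<times> ('g \<Rightarrow> real ^ 'n)"

abbreviation chart_dom :: "('g, 'n) chart \<Rightarrow> 'g set" where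
  "chart_dom \<equiv> fst"

abbreviation chart_map :: "('g, 'n) chart \<Rightarrow> 'g \<Rightarrow> real ^ 'n" where
  "chart_map \<equiv> snd"

definition chart_im :: "('g, 'n) chart \<Rightarrow> (real ^ 'n) set" where
  "chart_im c = chart_map c ` chart_dom c"

definition chart_inv :: "('g, 'n) chart \<Rightarrow> real ^ 'n \<Rightarrow> 'g" where
  "chart_inv c = inv_into (chart_dom c) (chart_map c)"

definition is_chart :: "('g::topological_space, 'n::finite) chart \<Rightarrow> bool" where
  "is_chart c \<longleftrightarrow> open (chart_dom c) \<and> open (chart_im c) \<and>
     homeomorphism (chart_dom c) (chart_im c) (chart_map c) (chart_inv c)"

definition smooth_transition ::
    "('g::topological_space, 'n::finite) chart \<Rightarrow> ('g, 'n) chart \<Rightarrow> bool" where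
  "smooth_transition c c' \<longleftrightarrow>
     smooth_on (chart_map c' \<circ> chart_inv c) (chart_map c ` (chart_dom c \<inter> chart_dom c'))"

text \<open>A smooth structure is a maximal smooth atlas.\<close>

definition smooth_structure :: "('g::topological_space, 'n::finite) chart set \<Rightarrow> bool" where
  "smooth_structure A \<longleftrightarrow>
     (\<forall>c\<in>A. is_chart c) \<and>
     (\<Union>c\<in>A. chart_dom c) = UNIV \<and>
     (\<forall>c\<in>A. \<forall>c'\<in>A. smooth_transition c c') \<and>
     (\<forall>c. is_chart c \<and> (\<forall>c'\<in>A. smooth_transition c c' \<and> smooth_transition c' c) \<longrightarrow> c \<in> A)"

text \<open>
  The group is written additively, in the classes \<^class>\<open>group_add\<close> and
  \<^class>\<open>topological_group_add\<close>, neither of which assumes commutativity: the product of \<open>x\<close> and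
  \<open>y\<close> is \<open>x + y\<close>, the inverse of \<open>x\<close> is \<open>- x\<close>, the identity is \<open>0\<close>, and left translation
  by \<open>x\<close> is \<open>\<lambda>y. x + y\<close>.
\<close>

definition lie_group ::
    "('g::{topological_group_add, second_countable_topology, t2_space}, 'n::finite) chart set \<Rightarrow> bool"
  where
  "lie_group A \<longleftrightarrow>
     smooth_structure A \<and>
     (\<forall>a\<in>A. \<forall>b\<in>A. \<forall>c\<in>A.
        smooth_on (\<lambda>(u, v). chart_map c (chart_inv a u + chart_inv b v))
          {(u, v). u \<in> chart_im a \<and> v \<in> chart_im b \<and> chart_inv a u + chart_inv b v \<in> chart_dom c}) \<and>
     (\<forall>a\<in>A. \<forall>c\<in>A.
        smooth_on (\<lambda>u. chart_map c (- chart_inv a u))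
          {u. u \<in> chart_im a \<and> - chart_inv a u \<in> chart_dom c})"


section \<open>Left-invariant Riemannian metrics\<close>

text \<open>
  A Riemannian metric is given by its component matrices: \<open>g c p\<close> is the Gram matrix, in the
  coordinates of the chart \<open>c\<close>, of the inner product on the tangent space at \<open>p\<close>.
\<close>

type_synonym ('g, 'n) metric_tensor = "('g, 'n) chart \<Rightarrow> 'g \<Rightarrow> real ^ 'n ^ 'n"

text \<open>
  \<open>isometric_at A g F p\<close>: in all charts around \<open>p\<close> and \<open>F p\<close>, the differential of \<open>F\<close> at \<open>p\<close>
  preserves the inner products given by \<open>g\<close>.
\<close>

definition isometric_at ::
    "('g::topological_space, 'n::finite) chart set \<Rightarrow> ('g, 'n) metric_tensor \<Rightarrow> ('g \<Rightarrow> 'g) \<Rightarrow> 'g \<Rightarrow> bool"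
  where
  "isometric_at A g F p \<longleftrightarrow>
     (\<forall>c\<in>A. \<forall>c'\<in>A. p \<in> chart_dom c \<and> F p \<in> chart_dom c' \<longrightarrow>
        (let D = frechet_derivative (\<lambda>u. chart_map c' (F (chart_inv c u))) (at (chart_map c p))
         in \<forall>u v. D u \<bullet> (g c' (F p) *v D v) = u \<bullet> (g c p *v v)))"

text \<open>The last clause is the transformation law of the components under a change of charts.\<close>

definition riemannian_metric ::
    "('g::topological_space, 'n::finite) chart set \<Rightarrow> ('g, 'n) metric_tensor \<Rightarrow> bool" where
  "riemannian_metric A g \<longleftrightarrow>
     (\<forall>c\<in>A. \<forall>p\<in>chart_dom c. transpose (g c p) = g c p \<and> (\<forall>u. u \<noteq> 0 \<longrightarrow> 0 < u \<bullet> (g c p *v u))) \<and>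
     (\<forall>c\<in>A. \<forall>i j. smooth_on (\<lambda>u. g c (chart_inv c u) $ i $ j) (chart_im c)) \<and>
     (\<forall>p. isometric_at A g (\<lambda>x. x) p)"

definition left_invariant_metric ::
    "('g::{topological_space, plus}, 'n::finite) chart set \<Rightarrow> ('g, 'n) metric_tensor \<Rightarrow> bool" where
  "left_invariant_metric A g \<longleftrightarrow> (\<forall>x p. isometric_at A g (\<lambda>y. x + y) p)"


section \<open>Riemannian distance and volume\<close>

definition C1_curve_on ::
    "('g::topological_space, 'n::finite) chart set \<Rightarrow> (real \<Rightarrow> 'g) \<Rightarrow> real \<Rightarrow> real \<Rightarrow> bool" where
  "C1_curve_on A \<gamma> a b \<longleftrightarrow>
     continuous_on {a..b} \<gamma> \<and>
     (\<forall>c\<in>A. \<exists>D. continuous_on {t\<in>{a..b}. \<gamma> t \<in> chart_dom c} D \<and>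
        (\<forall>t\<in>{a..b}. \<gamma> t \<in> chart_dom c \<longrightarrow>
           ((chart_map c \<circ> \<gamma>) has_vector_derivative D t) (at t within {a..b})))"

definition piecewise_C1_curve ::
    "('g::topological_space, 'n::finite) chart set \<Rightarrow> (real \<Rightarrow> 'g) \<Rightarrow> bool" where
  "piecewise_C1_curve A \<gamma> \<longleftrightarrow>
     (\<exists>(m::nat) \<tau>. \<tau> 0 = 0 \<and> \<tau> m = 1 \<and>
        (\<forall>i<m. \<tau> i < \<tau> (Suc i) \<and> C1_curve_on A \<gamma> (\<tau> i) (\<tau> (Suc i))))"

text \<open>
  The speed does not depend on the chart chosen. At the finitely many break points of a
  piecewise \<open>C\<^sup>1\<close> curve its value is unspecified, which does not affect the length.
\<close>

definition curve_speed ::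
    "('g, 'n::finite) chart set \<Rightarrow> ('g, 'n) metric_tensor \<Rightarrow> (real \<Rightarrow> 'g) \<Rightarrow> real \<Rightarrow> real" where
  "curve_speed A g \<gamma> t =
     (let c = (SOME c. c \<in> A \<and> \<gamma> t \<in> chart_dom c);
          v = vector_derivative (chart_map c \<circ> \<gamma>) (at t)
      in sqrt (v \<bullet> (g c (\<gamma> t) *v v)))"

definition curve_length ::
    "('g, 'n::finite) chart set \<Rightarrow> ('g, 'n) metric_tensor \<Rightarrow> (real \<Rightarrow> 'g) \<Rightarrow> ennreal" where
  "curve_length A g \<gamma> = (\<integral>\<^sup>+t\<in>{0..1}. ennreal (curve_speed A g \<gamma> t) \<partial>lborel)"

text \<open>Values in \<^typ>\<open>ennreal\<close>; the distance is finite when the space is connected.\<close>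

definition riemannian_dist ::
    "('g::topological_space, 'n::finite) chart set \<Rightarrow> ('g, 'n) metric_tensor \<Rightarrow> 'g \<Rightarrow> 'g \<Rightarrow> ennreal" where
  "riemannian_dist A g x y =
     (INF \<gamma> \<in> {\<gamma>. piecewise_C1_curve A \<gamma> \<and> \<gamma> 0 = x \<and> \<gamma> 1 = y}. curve_length A g \<gamma>)"

definition rball ::
    "('g::topological_space, 'n::finite) chart set \<Rightarrow> ('g, 'n) metric_tensor \<Rightarrow> 'g \<Rightarrow> real \<Rightarrow> 'g set" where
  "rball A g x r = {y. riemannian_dist A g x y < ennreal r}"

text \<open>
  The Riemannian volume is the Borel measure given by the density \<open>sqrt (det g)\<close> in every
  chart. On a second countable manifold exactly one measure has this property.
\<close>

definition is_riemannian_volume ::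
    "('g::topological_space, 'n::finite) chart set \<Rightarrow> ('g, 'n) metric_tensor \<Rightarrow> 'g measure \<Rightarrow> bool" where
  "is_riemannian_volume A g M \<longleftrightarrow>
     sets M = sets borel \<and>
     (\<forall>c\<in>A. \<forall>B\<in>sets borel. B \<subseteq> chart_dom c \<longrightarrow>
        emeasure M B =
          (\<integral>\<^sup>+u\<in>chart_map c ` B. ennreal (sqrt (det (g c (chart_inv c u)))) \<partial>lborel))"

definition modular_function :: "'g::{topological_space, plus} measure \<Rightarrow> 'g \<Rightarrow> real" where
  "modular_function M =
     (THE \<Delta>. (\<forall>x. 0 < \<Delta> x) \<and>
        (\<forall>x. \<forall>B\<in>sets borel. emeasure M ((\<lambda>b. b + x) ` B) = ennreal (\<Delta> x) * emeasure M B))"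


section \<open>Norms, radius-weights and averages\<close>

text \<open>Real powers of extended nonnegative reals, with \<open>x\<^sup>0 = 1\<close> for all \<open>x\<close>; only used for \<open>a \<ge> 0\<close>.\<close>

definition epowr :: "ennreal \<Rightarrow> real \<Rightarrow> ennreal" where
  "epowr x a = (if a = 0 then 1 else if x = \<infinity> then \<infinity> else ennreal (enn2real x powr a))"

definition Lq_norm :: "'a measure \<Rightarrow> ennreal \<Rightarrow> ('a \<Rightarrow> ennreal) \<Rightarrow> ennreal" where
  "Lq_norm M q h =
     (if q = \<infinity> then esssup M h
      else epowr (\<integral>\<^sup>+x. epowr (h x) (enn2real q) \<partial>M) (1 / enn2real q))"

text \<open>Only the values of a radius-weight on \<open>{0<..}\<close> matter.\<close>

definition weight_norm :: "(real \<Rightarrow> real) \<Rightarrow> ennreal" where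
  "weight_norm w = (\<integral>\<^sup>+r\<in>{0<..}. ennreal (w r) \<partial>lborel)"

definition radius_weight :: "(real \<Rightarrow> real) \<Rightarrow> bool" where
  "radius_weight w \<longleftrightarrow>
     w \<in> borel_measurable (restrict_space borel {0<..}) \<and>
     (\<forall>r>0. 0 \<le> w r) \<and>
     weight_norm w < \<infinity> \<and>
     (AE r in lborel. 0 < r \<longrightarrow> w r \<noteq> 0)"

definition weight_G_norm ::
    "('g::{topological_space, group_add}, 'n::finite) chart set \<Rightarrow> ('g, 'n) metric_tensor \<Rightarrow>
     'g measure \<Rightarrow> (real \<Rightarrow> real) \<Rightarrow> ennreal" where
  "weight_G_norm A g M w =
     (\<integral>\<^sup>+r\<in>{0<..}. ennreal (w r) / emeasure M (rball A g 0 r) *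
        (\<integral>\<^sup>+y\<in>rball A g 0 r. ennreal (modular_function M (- y)) \<partial>M) \<partial>lborel)"

definition F_loc ::
    "('g::topological_space, 'n::finite) chart set \<Rightarrow> ('g, 'n) metric_tensor \<Rightarrow>
     'g measure \<Rightarrow> ('g \<Rightarrow> real) set" where
  "F_loc A g M =
     {f \<in> borel_measurable M.
        \<forall>U\<in>sets borel. (\<exists>x r. U \<subseteq> rball A g x r) \<longrightarrow> (\<integral>\<^sup>+y\<in>U. ennreal \<bar>f y\<bar> \<partial>M) < \<infinity>}"

definition ball_average ::
    "('g::topological_space, 'n::finite) chart set \<Rightarrow> ('g, 'n) metric_tensor \<Rightarrow>
     'g measure \<Rightarrow> ('g \<Rightarrow> real) \<Rightarrow> 'g \<Rightarrow> real \<Rightarrow> ennreal" where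
  "ball_average A g M f x r =
     (\<integral>\<^sup>+y\<in>rball A g x r. ennreal \<bar>f y\<bar> \<partial>M) / emeasure M (rball A g x r)"

definition weight_measure :: "(real \<Rightarrow> real) \<Rightarrow> real measure" where
  "weight_measure w = density (restrict_space lborel {0<..}) (\<lambda>r. ennreal (w r))"

definition I_op ::
    "('g::topological_space, 'n::finite) chart set \<Rightarrow> ('g, 'n) metric_tensor \<Rightarrow>
     'g measure \<Rightarrow> ennreal \<Rightarrow> (real \<Rightarrow> real) \<Rightarrow> ('g \<Rightarrow> real) \<Rightarrow> 'g \<Rightarrow> ennreal" where
  "I_op A g M p w f x =
     (if p = \<infinity> then esssup (weight_measure w) (\<lambda>r. ball_average A g M f x r)
      else epowr
        (\<integral>\<^sup>+r\<in>{0<..}. ennreal (w r) * epowr (ball_average A g M f x r) (enn2real p) \<partial>lborel)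
        (1 / enn2real p))"

text \<open>\<open>(q - p) / (q p)\<close>, read as \<open>1 / p\<close> for \<open>q = \<infinity>\<close>; and \<open>1 / \<infinity> = 0\<close>.\<close>

definition recip_exponent :: "ennreal \<Rightarrow> real" where
  "recip_exponent p = (if p = \<infinity> then 0 else 1 / enn2real p)"

definition weight_exponent :: "ennreal \<Rightarrow> ennreal \<Rightarrow> real" where
  "weight_exponent p q =
     (if q = \<infinity> then recip_exponent p
      else (enn2real q - enn2real p) / (enn2real q * enn2real p))"

end

theory Submission
  imports Defs
begin

text \<open>
  Left invariance of the metric tensor makes left translations isometries. Hence the volume \<open>M\<close> is
  left-invariant (change of variables in charts), the ball around \<open>x\<close> is the translate by \<open>x\<close> of the
  ball \<open>B\<^sub>r\<close> around the identity, and all balls with radius \<open>r\<close> have the same volume. Uniqueness of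
  Haar measure up to a factor gives the modular function and \<open>M(- B) = \<integral>\<^sub>B \<Delta>(- y) dM(y)\<close>.

  For finite \<open>q\<close>, Jensen's inequality with respect to \<open>w(r) dr\<close> reduces the exponent \<open>p\<close> to \<open>q\<close> at the
  cost of a power of \<open>\<parallel>w\<parallel>\<close>, and Jensen's inequality on each ball bounds the \<open>q\<close>-th power of the
  average of \<open>\<bar>f\<bar>\<close> by the average of \<open>\<bar>f\<bar>\<^sup>q\<close>. Fubini's theorem turns the integral over the centres \<open>x\<close>
  into \<open>M {x. y \<in> x + B\<^sub>r} = M(y + (- B\<^sub>r)) = M(- B\<^sub>r)\<close>, and integrating \<open>w(r) M(- B\<^sub>r) / M(B\<^sub>r)\<close> over \<open>r\<close>
  yields \<open>\<parallel>w\<parallel>\<^sub>G\<close>. For \<open>q = \<infinity>\<close> every average is at most the essential supremum of \<open>\<bar>f\<bar>\<close>.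
\<close>

text \<open>Two obstacles shape the proof. Fubini and the essential suprema require the averages to
  be measurable in centre and radius, so the distance from the identity must be Borel. It is shown
  to be upper semicontinuous: a curve shorter than \<open>r\<close> stays so when its end is moved
  slightly inside a chart. Measurability of the speed of a curve is never established, so the length
  of the modified curve is estimated by an integral inequality with one unrestricted summand. The
  second obstacle is the uniqueness of Haar measure, which rests on a single exchange formula for
  two left-invariant measures. Comparing \<open>M\<close> with its right translates gives the
  modular function, and comparing \<open>M\<close> with itself gives the measure of inverted sets.
  The normalising set is a compact neighbourhood of the identity, all of whose right translates have
  positive finite measure. Integrals and averages stay in \<open>ennreal\<close>, where
  \<open>0 / 0 = 0\<close> and \<open>z / top = 0\<close> absorb balls of degenerate volume.\<close>

section \<open>Change of variables for nonnegative functions\<close>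

text \<open>
  The library's change of variables on \<open>real ^ 'n\<close> requires a well-ordered index type. The copy
  \<open>'a wo\<close> of a finite type \<open>'a\<close> is well-ordered by an enumeration.
\<close>

typedef 'a wo = "UNIV :: 'a set" by auto

instantiation wo :: (finite) wellorder
begin

definition "x \<le> y \<longleftrightarrow> to_nat (Rep_wo x) \<le> to_nat (Rep_wo y)"
definition "x < y \<longleftrightarrow> to_nat (Rep_wo x) < to_nat (Rep_wo y)"

instance
proof
  fix P :: "'a wo \<Rightarrow> bool" and x :: "'a wo"
  assume step: "\<And>x. (\<And>y. y < x \<Longrightarrow> P y) \<Longrightarrow> P x"
  show "P x"
    by (induction "to_nat (Rep_wo x)" arbitrary: x rule: less_induct)
      (use step less_wo_def in blast)
qed (auto simp: less_eq_wo_def less_wo_def Rep_wo_inject)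

end

instance wo :: (finite) finite
proof
  have "(UNIV :: 'a wo set) = Abs_wo ` UNIV"
    by (metis Abs_wo_cases surj_def)
  then show "finite (UNIV :: 'a wo set)"
    by (metis finite finite_imageI)
qed

lemma bij_Rep_wo: "bij Rep_wo"
  by (metis Abs_wo_inverse Rep_wo_inverse UNIV_I bij_iff)

text \<open>Conjugation with \<open>r\<close> is a sign-preserving bijection between the
  permutations of the two index types, so the two Leibniz sums agree term by term.\<close>

lemma det_reindex:
  fixes A :: "'a::comm_ring_1 ^ 'n ^ 'n" and r :: "'m::finite \<Rightarrow> 'n::finite"
  assumes "bij r"
  shows "det (\<chi> i j. A $ r i $ r j) = det A"
proof -
  have inj: "inj r" and surj: "range r = UNIV"
    using assms by (auto simp: bij_def)
  have app: "map_permutation UNIV r p (r i) = r (p i)" for p i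
    using map_permutation_apply[OF inj, of i p] by simp
  have bij: "bij_betw (map_permutation UNIV r) {p. p permutes UNIV} {q. q permutes UNIV}"
  proof (rule bij_betw_byWitness[where f' = "\<lambda>q. inv r \<circ> q \<circ> r"])
    show "\<forall>p\<in>{p. p permutes UNIV}. inv r \<circ> map_permutation UNIV r p \<circ> r = p"
      by (auto simp: fun_eq_iff app inv_f_f[OF inj])
    show "\<forall>q\<in>{q. q permutes UNIV}. map_permutation UNIV r (inv r \<circ> q \<circ> r) = q"
      by (auto simp: fun_eq_iff map_permutation_def restrict_id_def surj surj_f_inv_f)
    show "map_permutation UNIV r ` {p. p permutes UNIV} \<subseteq> {q. q permutes UNIV}"
      using map_permutation_permutes[of r UNIV UNIV] assms by auto
    show "(\<lambda>q. inv r \<circ> q \<circ> r) ` {q. q permutes UNIV} \<subseteq> {p. p permutes UNIV}"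
      using assms by (auto simp: permutes_univ bij_imp_bij_inv bij_comp bij_def[symmetric]
        simp flip: bij_iff intro!: bij_comp)
  qed
  have "det A = (\<Sum>q | q permutes UNIV. of_int (sign q) * (\<Prod>i\<in>UNIV. A $ i $ q i))"
    by (simp add: det_def)
  also have "\<dots> = (\<Sum>p | p permutes UNIV. of_int (sign (map_permutation UNIV r p)) *
      (\<Prod>i\<in>UNIV. A $ i $ map_permutation UNIV r p i))"
    by (rule sum.reindex_bij_betw[OF bij, symmetric])
  also have "\<dots> = (\<Sum>p | p permutes UNIV. of_int (sign p) * (\<Prod>i\<in>UNIV. A $ r i $ r (p i)))"
  proof (intro sum.cong refl arg_cong2[where f = "(*)"])
    fix p :: "'m \<Rightarrow> 'm" assume "p \<in> {p. p permutes UNIV}"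
    then show "(of_int (sign (map_permutation UNIV r p)) :: 'a) = of_int (sign p)"
      by (subst sign_map_permutation[OF inj]) auto
    show "(\<Prod>i\<in>UNIV. A $ i $ map_permutation UNIV r p i) = (\<Prod>i\<in>UNIV. A $ r i $ r (p i))"
      using prod.reindex_bij_betw[OF assms, of "\<lambda>i. A $ i $ map_permutation UNIV r p i"]
      by (simp add: app)
  qed
  also have "\<dots> = det (\<chi> i j. A $ r i $ r j)"
    by (simp add: det_def)
  finally show ?thesis ..
qed

text \<open>\<open>has_absolute_integral_change_of_variables\<close> compares finite integrals.
  Translated by \<open>eq\<close>, it says that one side equals a given finite number if and only if
  the other does, and this forces equality in the infinite case too. Measurability is asked of
  products with indicators because the densities used later are continuous only on the image of a
  chart.\<close>

lemma nn_integral_change_of_variables_wellorder: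
  fixes F :: "real ^ 'm::{finite,wellorder} \<Rightarrow> real ^ 'm::_"
  assumes S: "S \<in> sets borel" and FS: "F ` S \<in> sets borel"
    and der: "\<And>x. x \<in> S \<Longrightarrow> (F has_derivative F' x) (at x)"
    and inj: "inj_on F S"
    and h: "\<And>x. 0 \<le> h x" "(\<lambda>x. h x * indicator (F ` S) x) \<in> borel_measurable borel"
    and k: "(\<lambda>x. \<bar>det (matrix (F' x))\<bar> * h (F x) * indicator S x) \<in> borel_measurable borel"
  shows "(\<integral>\<^sup>+x\<in>F ` S. ennreal (h x) \<partial>lborel)
    = (\<integral>\<^sup>+x\<in>S. ennreal (\<bar>det (matrix (F' x))\<bar> * h (F x)) \<partial>lborel)"
proof -
  let ?J = "\<lambda>x. \<bar>det (matrix (F' x))\<bar> * h (F x)"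
  have eq: "(\<integral>\<^sup>+x\<in>T. ennreal (u x) \<partial>lborel) = ennreal b \<longleftrightarrow> (u has_integral b) T"
    if "0 \<le> b" "\<And>x. 0 \<le> u x" "(\<lambda>x. u x * indicator T x) \<in> borel_measurable borel"
    for T and u :: "real ^ 'm::_ \<Rightarrow> real" and b
  proof -
    have "(\<integral>\<^sup>+x\<in>T. ennreal (u x) \<partial>lborel) = (\<integral>\<^sup>+x. ennreal (u x * indicator T x) \<partial>lebesgue)"
      unfolding nn_integral_completion by (intro nn_integral_cong) (auto simp: indicator_def)
    moreover have "(\<lambda>x. u x * indicator T x) \<in> borel_measurable lebesgue"
      using that(3) by (simp add: measurable_completion)
    ultimately have "(\<integral>\<^sup>+x\<in>T. ennreal (u x) \<partial>lborel) = ennreal b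
        \<longleftrightarrow> ((\<lambda>x. u x * indicator T x) has_integral b) UNIV"
      using that by (subst has_integral_iff_nn_integral_lebesgue) auto
    also have "(\<lambda>x. u x * indicator T x) = (\<lambda>x. if x \<in> T then u x else 0)"
      by (auto simp: indicator_def)
    finally show ?thesis
      by (simp only: has_integral_restrict_UNIV)
  qed
  have S': "S \<in> sets lebesgue"
    using S by (metis sets_completionI_sets sets_lborel)
  \<comment> \<open>The library theorem treats vector-valued integrands; \<open>real ^ 1\<close>
    carries the scalar case.\<close>
  have "(\<lambda>x. \<bar>det (matrix (F' x))\<bar> *\<^sub>R (vec (h (F x)) :: real ^ 1)) absolutely_integrable_on S \<and>
           integral S (\<lambda>x. \<bar>det (matrix (F' x))\<bar> *\<^sub>R (vec (h (F x)) :: real ^ 1)) = vec b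
         \<longleftrightarrow> (\<lambda>x. vec (h x) :: real ^ 1) absolutely_integrable_on (F ` S) \<and>
           integral (F ` S) (\<lambda>x. vec (h x)) = (vec b :: real ^ 1)" for b
    by (rule has_absolute_integral_change_of_variables[OF S' _ inj])
      (use der in \<open>auto intro: has_derivative_at_withinI\<close>)
  then have "?J absolutely_integrable_on S \<and> integral S ?J = b
         \<longleftrightarrow> h absolutely_integrable_on (F ` S) \<and> integral (F ` S) h = b" for b
    by (simp add: absolutely_integrable_on_1_iff integral_on_1_eq)
  then have "(?J has_integral b) S \<longleftrightarrow> (h has_integral b) (F ` S)" for b
    using h(1) by (simp add: has_integral_iff absolutely_integrable_on_iff_nonneg)
  then have *: "(\<integral>\<^sup>+x\<in>F ` S. ennreal (h x) \<partial>lborel) = ennreal b \<longleftrightarrow>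
      (\<integral>\<^sup>+x\<in>S. ennreal (?J x) \<partial>lborel) = ennreal b" if "0 \<le> b" for b
    using that h k by (subst (1 2) eq) auto
  have eqI: "X = Y" if "\<And>b. 0 \<le> b \<Longrightarrow> X = ennreal b \<longleftrightarrow> Y = ennreal b" for X Y :: ennreal
  proof (cases X)
    case (real b)
    then show ?thesis
      using that[of b] by blast
  next
    case top
    then show ?thesis
      using that[of "enn2real Y"] by (cases Y) auto
  qed
  show ?thesis
    by (rule eqI) (rule *)
qed

section \<open>Relabelling of coordinates and arbitrary finite index types\<close>

definition to_wo :: "'a ^ 'n \<Rightarrow> 'a ^ 'n wo" where
  "to_wo x = (\<chi> i. x $ Rep_wo i)"

definition of_wo :: "'a ^ 'n wo \<Rightarrow> 'a ^ 'n" where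
  "of_wo x = (\<chi> i. x $ Abs_wo i)"

lemma to_wo_nth [simp]: "to_wo x $ i = x $ Rep_wo i"
  and of_wo_nth [simp]: "of_wo y $ j = y $ Abs_wo j"
  by (simp_all add: to_wo_def of_wo_def)

lemma to_wo_of_wo [simp]: "to_wo (of_wo x) = x"
  and of_wo_to_wo [simp]: "of_wo (to_wo y) = y"
  by (simp_all add: vec_eq_iff Rep_wo_inverse Abs_wo_inverse)

lemma bounded_linear_to_wo: "bounded_linear (to_wo :: real ^ 'n::finite \<Rightarrow> real ^ 'n wo)"
  and bounded_linear_of_wo: "bounded_linear (of_wo :: real ^ 'n wo \<Rightarrow> real ^ 'n::finite)"
  by (auto intro!: linearI simp: vec_eq_iff simp flip: linear_conv_bounded_linear)

lemma measurable_to_wo [measurable]: "(to_wo :: real ^ 'n::finite \<Rightarrow> _) \<in> borel \<rightarrow>\<^sub>M borel"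
  and measurable_of_wo [measurable]: "(of_wo :: _ \<Rightarrow> real ^ 'n::finite) \<in> borel \<rightarrow>\<^sub>M borel"
  by (auto intro!: borel_measurable_continuous_onI linear_continuous_on
    bounded_linear_to_wo bounded_linear_of_wo)

text \<open>Boxes determine Lebesgue measure, and relabelling carries boxes to boxes with the same
  edge lengths.\<close>

lemma distr_of_wo: "distr lborel borel (of_wo :: _ \<Rightarrow> real ^ 'n::finite) = lborel"
proof (rule lborel_eqI[symmetric])
  fix l u :: "real ^ 'n"
  assume le: "\<And>b. b \<in> Basis \<Longrightarrow> l \<bullet> b \<le> u \<bullet> b"
  have le': "l $ i \<le> u $ i" for i
    using le[of "axis i 1"] by (simp add: inner_axis axis_in_Basis_iff)
  have "x \<in> box (to_wo l) (to_wo u)" if "of_wo x \<in> box l u" for x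
    using that unfolding mem_box_cart
    by (metis of_wo_nth Rep_wo_inverse to_wo_nth)
  moreover have "of_wo x \<in> box l u" if "x \<in> box (to_wo l) (to_wo u)" for x
    using that unfolding mem_box_cart
    by (metis of_wo_nth Abs_wo_inverse to_wo_nth UNIV_I)
  ultimately have "of_wo -` box l u = box (to_wo l) (to_wo u)"
    by auto
  moreover have prod_eq: "(\<Prod>b\<in>Basis. (y - x) \<bullet> b) = (\<Prod>i\<in>UNIV. y $ i - x $ i)"
    for x y :: "real ^ 'm::finite"
    by (simp add: Basis_vec_def UNION_singleton_eq_range prod.reindex inj_on_def axis_eq_axis
      inner_axis)
  moreover have "(\<Prod>i\<in>UNIV. to_wo u $ i - to_wo l $ i) = (\<Prod>i\<in>UNIV. u $ i - l $ i)"
    using prod.reindex_bij_betw[OF bij_Rep_wo, of "\<lambda>i. u $ i - l $ i"] by simp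
  moreover have "to_wo l \<bullet> b \<le> to_wo u \<bullet> b" if "b \<in> Basis" for b
    using that le' by (auto simp: Basis_vec_def inner_axis)
  ultimately show "emeasure (distr lborel borel of_wo) (box l u) = (\<Prod>b\<in>Basis. (u - l) \<bullet> b)"
    by (simp add: emeasure_distr emeasure_lborel_box prod_eq del: to_wo_nth)
qed simp

lemma nn_integral_of_wo:
  fixes u :: "real ^ 'n::finite \<Rightarrow> ennreal"
  assumes "u \<in> borel_measurable borel"
  shows "(\<integral>\<^sup>+x. u x \<partial>lborel) = (\<integral>\<^sup>+y. u (of_wo y) \<partial>lborel)"
  using assms by (subst distr_of_wo[symmetric], subst nn_integral_distr) auto

text \<open>Relabelling on both sides turns \<open>F\<close> into a map \<open>G\<close> over a
  well-ordered index type. This preserves Lebesgue measure and, by \<open>det_reindex\<close>, the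
  Jacobian determinant.\<close>

lemma nn_integral_change_of_variables:
  fixes F :: "real ^ 'n::finite \<Rightarrow> real ^ 'n"
  assumes S: "S \<in> sets borel" and FS: "F ` S \<in> sets borel"
    and der: "\<And>x. x \<in> S \<Longrightarrow> (F has_derivative F' x) (at x)"
    and inj: "inj_on F S"
    and h: "\<And>x. 0 \<le> h x" "(\<lambda>x. h x * indicator (F ` S) x) \<in> borel_measurable borel"
    and k: "(\<lambda>x. \<bar>det (matrix (F' x))\<bar> * h (F x) * indicator S x) \<in> borel_measurable borel"
  shows "(\<integral>\<^sup>+x\<in>F ` S. ennreal (h x) \<partial>lborel)
    = (\<integral>\<^sup>+x\<in>S. ennreal (\<bar>det (matrix (F' x))\<bar> * h (F x)) \<partial>lborel)"
proof -
  define G where "G y = to_wo (F (of_wo y))" for y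
  define G' where "G' y v = to_wo (F' (of_wo y) (of_wo v))" for y v
  let ?T = "of_wo -` S"
  have GT: "G ` ?T = of_wo -` (F ` S)"
  proof safe
    fix y x assume "of_wo y = F x" "x \<in> S"
    then show "y \<in> G ` ?T"
      unfolding G_def by (intro image_eqI[of _ _ "to_wo x"]) (auto simp flip: \<open>of_wo y = F x\<close>)
  qed (auto simp: G_def)
  have T: "?T \<in> sets borel" "G ` ?T \<in> sets borel"
    unfolding GT using S FS measurable_sets[OF measurable_of_wo] by auto
  have det: "det (matrix (G' y)) = det (matrix (F' (of_wo y)))" for y
  proof -
    have "of_wo (axis i 1) = (axis (Rep_wo i) 1 :: real ^ 'n)" for i
      by (auto simp: vec_eq_iff axis_def Abs_wo_inverse Rep_wo_inverse)
    then have "matrix (G' y) $ i $ j = matrix (F' (of_wo y)) $ Rep_wo i $ Rep_wo j" for i j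
      by (simp only: matrix_def G'_def vec_lambda_beta to_wo_nth)
    then have "matrix (G' y) = (\<chi> i j. matrix (F' (of_wo y)) $ Rep_wo i $ Rep_wo j)"
      by (simp only: vec_eq_iff vec_lambda_beta simp_thms)
    then show ?thesis
      using det_reindex[OF bij_Rep_wo] by metis
  qed
  have "(\<integral>\<^sup>+x\<in>F ` S. ennreal (h x) \<partial>lborel) = (\<integral>\<^sup>+x. ennreal (h x * indicator (F ` S) x) \<partial>lborel)"
    by (intro nn_integral_cong) (auto simp: indicator_def)
  also have "\<dots> = (\<integral>\<^sup>+y. ennreal (h (of_wo y) * indicator (F ` S) (of_wo y)) \<partial>lborel)"
    by (rule nn_integral_of_wo) (use h(2) in measurable)
  also have "\<dots> = (\<integral>\<^sup>+y\<in>G ` ?T. ennreal (h (of_wo y)) \<partial>lborel)"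
    unfolding GT by (intro nn_integral_cong) (auto simp: indicator_def)
  also have "\<dots> = (\<integral>\<^sup>+y\<in>?T. ennreal (\<bar>det (matrix (G' y))\<bar> * h (of_wo (G y))) \<partial>lborel)"
  proof (rule nn_integral_change_of_variables_wellorder[OF T])
    show "(G has_derivative G' y) (at y)" if "y \<in> ?T" for y
      unfolding G_def G'_def
      by (intro bounded_linear.has_derivative[OF bounded_linear_to_wo]
          has_derivative_compose[of of_wo, OF _ der]
          bounded_linear_imp_has_derivative bounded_linear_of_wo) (use that in auto)
    show "inj_on G ?T"
    proof (rule inj_onI)
      fix y z assume *: "y \<in> ?T" "z \<in> ?T" "G y = G z"
      then have "F (of_wo y) = F (of_wo z)"
        unfolding G_def by (metis of_wo_to_wo)
      then have "of_wo y = of_wo z"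
        using * inj by (auto dest: inj_onD)
      then show "y = z"
        by (metis to_wo_of_wo)
    qed
    have "(\<lambda>y. (\<lambda>x. h x * indicator (F ` S) x) (of_wo y)) \<in> borel_measurable borel"
      using h(2) by measurable
    then show "(\<lambda>y. h (of_wo y) * indicator (G ` ?T) y) \<in> borel_measurable borel"
      unfolding GT by (simp add: indicator_def)
    have "(\<lambda>y. (\<lambda>x. \<bar>det (matrix (F' x))\<bar> * h (F x) * indicator S x) (of_wo y)) \<in> borel_measurable borel"
      using k by measurable
    then show "(\<lambda>y. \<bar>det (matrix (G' y))\<bar> * h (of_wo (G y)) * indicator ?T y) \<in> borel_measurable borel"
      unfolding det by (simp add: indicator_def G_def)
  qed (use h in auto)
  also have "\<dots> = (\<integral>\<^sup>+y. (\<lambda>x. ennreal (\<bar>det (matrix (F' x))\<bar> * h (F x) * indicator S x)) (of_wo y) \<partial>lborel)"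
    by (intro nn_integral_cong) (auto simp: indicator_def det G_def)
  also have "\<dots> = (\<integral>\<^sup>+x. ennreal (\<bar>det (matrix (F' x))\<bar> * h (F x) * indicator S x) \<partial>lborel)"
    by (rule nn_integral_of_wo[symmetric]) (use k in measurable)
  also have "\<dots> = (\<integral>\<^sup>+x\<in>S. ennreal (\<bar>det (matrix (F' x))\<bar> * h (F x)) \<partial>lborel)"
    by (intro nn_integral_cong) (auto simp: indicator_def)
  finally show ?thesis .
qed

section \<open>The modular function of a left-invariant measure\<close>

locale left_invariant_measure = sigma_finite_measure M
  for M :: "'g::{topological_group_add, second_countable_topology} measure" +
  assumes sets_M: "sets M = sets borel"
    and emeasure_translate: "B \<in> sets borel \<Longrightarrow> emeasure M ((+) x ` B) = emeasure M B"
begin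

lemma space_M [simp]: "space M = UNIV"
  using sets_eq_imp_space_eq[OF sets_M] by simp

lemma measurable_M_cong [measurable_cong]: "sets M = sets borel"
  by (rule sets_M)

lemma nn_integral_translate:
  assumes [measurable]: "h \<in> borel_measurable borel"
  shows "(\<integral>\<^sup>+y. h (x + y) \<partial>M) = (\<integral>\<^sup>+y. h y \<partial>M)"
proof -
  have [measurable]: "(+) x \<in> borel \<rightarrow>\<^sub>M borel"
    by (intro borel_measurable_continuous_onI continuous_intros)
  have "distr M borel ((+) x) = M"
  proof (rule measure_eqI)
    fix B assume "B \<in> sets (distr M borel ((+) x))"
    then have B [measurable]: "B \<in> sets borel"
      by simp
    have "(+) x -` B = (+) (- x) ` B"
      by (force simp: image_iff add.assoc[symmetric])
    then show "emeasure (distr M borel ((+) x)) B = emeasure M B"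
      using emeasure_translate[OF B, of "- x"] by (subst emeasure_distr) auto
  qed (simp add: sets_M)
  then have "(\<integral>\<^sup>+y. h y \<partial>M) = (\<integral>\<^sup>+y. h y \<partial>distr M borel ((+) x))"
    by simp
  also have "\<dots> = (\<integral>\<^sup>+y. h (x + y) \<partial>M)"
    by (rule nn_integral_distr) auto
  finally show ?thesis ..
qed

end

section \<open>Measurable group operations and the exchange of two left-invariant integrals\<close>

lemma borel_measurable_add_group [measurable (raw)]:
  fixes f g :: "'a \<Rightarrow> 'g::{topological_group_add, second_countable_topology}"
  assumes "f \<in> borel_measurable M" "g \<in> borel_measurable M"
  shows "(\<lambda>x. f x + g x) \<in> borel_measurable M"
  by (rule borel_measurable_continuous_Pair[OF assms])
    (auto intro!: continuous_on_add continuous_on_fst continuous_on_snd continuous_on_id)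

lemma borel_measurable_uminus_group [measurable (raw)]:
  fixes f :: "'a \<Rightarrow> 'g::topological_group_add"
  assumes "f \<in> borel_measurable M"
  shows "(\<lambda>x. - f x) \<in> borel_measurable M"
  using measurable_compose[OF assms borel_measurable_continuous_onI[of uminus]]
  by (simp add: continuous_on_minus continuous_on_id)

lemma borel_measurable_diff_group [measurable (raw)]:
  fixes f g :: "'a \<Rightarrow> 'g::{topological_group_add, second_countable_topology}"
  assumes "f \<in> borel_measurable M" "g \<in> borel_measurable M"
  shows "(\<lambda>x. f x - g x) \<in> borel_measurable M"
  using assms unfolding diff_conv_add_uminus by measurable

text \<open>
  The substitutions \<open>y \<mapsto> - x + y\<close> and then \<open>x \<mapsto> y + x\<close>, with Fubini in between,
  move the product of the two integrals into the form on the right.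
\<close>

lemma nn_integral_left_invariant_exchange:
  fixes M N :: "'g::{topological_group_add, second_countable_topology} measure"
  assumes "left_invariant_measure M" "left_invariant_measure N"
    and [measurable]: "h \<in> borel_measurable borel" "k \<in> borel_measurable borel"
  shows "(\<integral>\<^sup>+x. h x \<partial>N) * (\<integral>\<^sup>+y. k (- y) \<partial>M) = (\<integral>\<^sup>+x. k x * (\<integral>\<^sup>+y. h (y + x) \<partial>M) \<partial>N)"
proof -
  interpret M: left_invariant_measure M by fact
  interpret N: left_invariant_measure N by fact
  interpret pair_sigma_finite M N ..
  note [measurable_cong] = M.sets_M N.sets_M
  have "(\<integral>\<^sup>+x. h x \<partial>N) * (\<integral>\<^sup>+y. k (- y) \<partial>M) = (\<integral>\<^sup>+x. h x * (\<integral>\<^sup>+y. k (- y) \<partial>M) \<partial>N)"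
    by (simp add: nn_integral_multc)
  also have "\<dots> = (\<integral>\<^sup>+x. h x * (\<integral>\<^sup>+y. k (- y + x) \<partial>M) \<partial>N)"
  proof -
    have "(\<integral>\<^sup>+y. k (- y) \<partial>M) = (\<integral>\<^sup>+y. k (- y + x) \<partial>M)" for x
      using M.nn_integral_translate[of "\<lambda>y. k (- y)" "- x"] by (simp add: minus_add)
    then show ?thesis
      by metis
  qed
  also have "\<dots> = (\<integral>\<^sup>+x. \<integral>\<^sup>+y. h x * k (- y + x) \<partial>M \<partial>N)"
    by (subst nn_integral_cmult) auto
  also have "\<dots> = (\<integral>\<^sup>+y. \<integral>\<^sup>+x. h x * k (- y + x) \<partial>N \<partial>M)"
    by (rule Fubini') measurable
  also have "\<dots> = (\<integral>\<^sup>+y. \<integral>\<^sup>+x. h (y + x) * k x \<partial>N \<partial>M)"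
  proof (rule nn_integral_cong)
    fix y
    show "(\<integral>\<^sup>+x. h x * k (- y + x) \<partial>N) = (\<integral>\<^sup>+x. h (y + x) * k x \<partial>N)"
      using N.nn_integral_translate[of "\<lambda>x. h x * k (- y + x)" y]
      by (simp add: add.assoc[symmetric])
  qed
  also have "\<dots> = (\<integral>\<^sup>+x. \<integral>\<^sup>+y. h (y + x) * k x \<partial>M \<partial>N)"
    by (rule Fubini'[symmetric]) measurable
  also have "\<dots> = (\<integral>\<^sup>+x. k x * (\<integral>\<^sup>+y. h (y + x) \<partial>M) \<partial>N)"
    by (intro nn_integral_cong, subst nn_integral_cmult[symmetric]) (auto simp: mult.commute)
  finally show ?thesis .
qed

text \<open>\<open>E\<close> is the yardstick by which left-invariant measures are normalised. All
  its right translates are controlled because the uniqueness formula divides by their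
  measures.\<close>

locale haar_measure = left_invariant_measure M
  for M :: "'g::{topological_group_add, second_countable_topology} measure" +
  fixes E :: "'g set"
  assumes E [measurable]: "E \<in> sets borel"
    and emeasure_E_pos: "0 < emeasure M ((\<lambda>b. b + x) ` E)"
    and emeasure_E_finite: "emeasure M ((\<lambda>b. b + x) ` E) < \<infinity>"
begin

lemma image_right_translate: "(\<lambda>b. b + x) ` B = (\<lambda>y. y - x) -` B" for x :: 'g
  by (force simp: image_iff)

lemma right_translate_borel [measurable]:
  fixes x :: 'g
  assumes [measurable]: "B \<in> sets borel"
  shows "(\<lambda>b. b + x) ` B \<in> sets borel"
  unfolding image_right_translate using measurable_sets[of "\<lambda>y. y - x" borel borel B] by simp

text \<open>This measure gives \<open>B\<close> the mass of \<open>B + a\<close>. Left and right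
  translations commute, which transfers left invariance. Translating a countable cover by sets of
  finite measure with \<open>- a\<close> from the right gives such a cover for the new
  measure.\<close>

lemma left_invariant_right_translate:
  "left_invariant_measure (distr M borel (\<lambda>y. y - a))" (is "left_invariant_measure ?N")
proof
  have em: "emeasure ?N B = emeasure M ((\<lambda>b. b + a) ` B)" if "B \<in> sets borel" for B
    using that by (subst emeasure_distr) (auto simp: image_right_translate sets_M)
  show "sets ?N = sets borel"
    by simp
  show "emeasure ?N ((+) x ` B) = emeasure ?N B" if B [measurable]: "B \<in> sets borel" for B x
  proof -
    have "(+) x ` B = (+) (- x) -` B"
      by (force simp: image_iff add.assoc[symmetric])
    then have "(+) x ` B \<in> sets borel"
      using measurable_sets[of "(+) (- x)" borel borel B] by simp
    moreover have "(\<lambda>b. b + a) ` (+) x ` B = (+) x ` (\<lambda>b. b + a) ` B"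
      by (simp add: image_image add.assoc)
    ultimately show ?thesis
      using em emeasure_translate[OF right_translate_borel[OF B, of a], of x] by simp
  qed
  obtain C :: "nat \<Rightarrow> 'g set" where C: "range C \<subseteq> sets M" "(\<Union>i. C i) = space M"
      "\<And>i. emeasure M (C i) \<noteq> \<infinity>"
    using sigma_finite by metis
  define C' where "C' i = (\<lambda>b. b - a) ` C i" for i
  have C'_borel [measurable]: "C' i \<in> sets borel" for i
  proof -
    have "C' i = (\<lambda>y. y + a) -` C i"
      unfolding C'_def by (force simp: image_iff)
    then show ?thesis
      using measurable_sets[of "\<lambda>y. y + a" borel borel "C i"] C(1) by (auto simp: sets_M)
  qed
  have C'_translate: "(\<lambda>b. b + a) ` C' i = C i" for i
    unfolding C'_def by (simp add: image_image)
  have "y \<in> (\<Union>i. C' i)" for y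
  proof -
    obtain i where "y + a \<in> C i"
      using C(2) by auto
    then have "y + a - a \<in> C' i"
      unfolding C'_def by (rule imageI)
    then show ?thesis
      by auto
  qed
  moreover have "emeasure ?N (C' i) \<noteq> \<infinity>" for i
    using C(3) by (simp add: em C'_translate)
  ultimately show "\<exists>A. countable A \<and> A \<subseteq> sets ?N \<and> \<Union> A = space ?N \<and> (\<forall>a\<in>A. emeasure ?N a \<noteq> \<infinity>)"
    using C'_borel by (intro exI[of _ "range C'"]) auto
qed

text \<open>
  Apply the exchange formula to the indicator of \<open>E\<close> and to \<open>h\<close> divided by the positive
  finite function \<open>x \<mapsto> M(E - x)\<close>. The second factor on the right does not depend on \<open>N\<close>.
\<close>

lemma left_invariant_unique:
  assumes N: "left_invariant_measure N" and [measurable]: "h \<in> borel_measurable borel"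
  shows "(\<integral>\<^sup>+x. h x \<partial>N) = emeasure N E * (\<integral>\<^sup>+y. h (- y) / emeasure M ((\<lambda>b. b + y) ` E) \<partial>M)"
proof -
  interpret N: left_invariant_measure N by fact
  define D where "D x = (\<integral>\<^sup>+y. indicator E (y + x) \<partial>M)" for x
  have [measurable]: "D \<in> borel_measurable borel"
    unfolding D_def by measurable
  have D: "D (- x) = emeasure M ((\<lambda>b. b + x) ` E)" for x
  proof -
    have "D (- x) = (\<integral>\<^sup>+y. indicator ((\<lambda>b. b + x) ` E) y \<partial>M)"
      unfolding D_def image_right_translate by (intro nn_integral_cong) (auto simp: indicator_def)
    also have "\<dots> = emeasure M ((\<lambda>b. b + x) ` E)"
      by (rule nn_integral_indicator) (simp add: sets_M)
    finally show ?thesis .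
  qed
  have "D x \<noteq> 0" "D x \<noteq> \<infinity>" for x
    using D[of "- x"] emeasure_E_pos[of "- x"] emeasure_E_finite[of "- x"] by auto
  then have *: "h x / D x * D x = h x" for x
    by (simp add: ennreal_divide_times ennreal_divide_self less_top[symmetric])
  have "(\<integral>\<^sup>+x. indicator E x \<partial>N) * (\<integral>\<^sup>+y. h (- y) / D (- y) \<partial>M) = (\<integral>\<^sup>+x. h x / D x * D x \<partial>N)"
    using nn_integral_left_invariant_exchange[OF left_invariant_measure_axioms N,
        of "indicator E" "\<lambda>x. h x / D x"]
    unfolding D_def[symmetric] by simp
  then show ?thesis
    unfolding * D by (simp add: N.sets_M)
qed

text \<open>By \<open>left_invariant_unique\<close>, the masses of \<open>B\<close> under
  \<open>M\<close> and under its right translate are the respective masses of \<open>E\<close> times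
  one common factor. Cross-multiplication removes this factor, which may be infinite, without a
  division.\<close>

lemma emeasure_right_translate_cross:
  assumes B [measurable]: "B \<in> sets borel"
  shows "emeasure M ((\<lambda>b. b + x) ` B) * emeasure M E = emeasure M ((\<lambda>b. b + x) ` E) * emeasure M B"
proof -
  let ?N = "distr M borel (\<lambda>y. y - x)"
  have N: "emeasure ?N C = emeasure M ((\<lambda>b. b + x) ` C)" if "C \<in> sets borel" for C
    using that by (subst emeasure_distr) (auto simp: image_right_translate sets_M)
  have "emeasure ?N B * emeasure M E = emeasure ?N E * emeasure M B"
    using left_invariant_unique[OF left_invariant_right_translate, of "indicator B" x]
      left_invariant_unique[OF left_invariant_measure_axioms, of "indicator B"]
    by (simp add: sets_M mult_ac)
  then show ?thesis
    by (simp add: N)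
qed

lemma emeasure_E: "0 < emeasure M E" "emeasure M E < \<infinity>"
  using emeasure_E_pos[of 0] emeasure_E_finite[of 0] by auto

text \<open>The ratio of the masses of \<open>E + x\<close> and \<open>E\<close> fits the
  description in \<open>modular_function\<close>. Any other candidate agrees with it, since it can
  be tested on \<open>E\<close>, whose positive finite mass cancels.\<close>

lemma emeasure_right_translate:
  assumes B: "B \<in> sets borel"
  shows "emeasure M ((\<lambda>b. b + x) ` B) = ennreal (modular_function M x) * emeasure M B"
proof -
  let ?P = "\<lambda>\<Delta>. (\<forall>x. 0 < \<Delta> x) \<and>
        (\<forall>x. \<forall>B\<in>sets borel. emeasure M ((\<lambda>b. b + x) ` B) = ennreal (\<Delta> x) * emeasure M B)"
  define \<Delta> where "\<Delta> x = enn2real (emeasure M ((\<lambda>b. b + x) ` E) / emeasure M E)" for x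
  have fin: "emeasure M ((\<lambda>b. b + x) ` E) / emeasure M E < \<infinity>"
    and pos: "0 < emeasure M ((\<lambda>b. b + x) ` E) / emeasure M E" for x
    using emeasure_E emeasure_E_pos[of x] emeasure_E_finite[of x]
    by (auto simp: less_top[symmetric] ennreal_divide_eq_top_iff ennreal_zero_less_divide)
  have ex: "?P \<Delta>"
  proof (intro conjI allI ballI)
    show "0 < \<Delta> x" for x
      unfolding \<Delta>_def using fin[of x] pos[of x] by (simp add: enn2real_positive_iff)
    show "emeasure M ((\<lambda>b. b + x) ` B) = ennreal (\<Delta> x) * emeasure M B" if "B \<in> sets borel" for x B
    proof -
      have "emeasure M ((\<lambda>b. b + x) ` B) = emeasure M ((\<lambda>b. b + x) ` B) * emeasure M E / emeasure M E"
        using emeasure_E by (simp add: ennreal_mult_divide_eq)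
      also have "\<dots> = emeasure M ((\<lambda>b. b + x) ` E) / emeasure M E * emeasure M B"
        unfolding emeasure_right_translate_cross[OF that]
        by (simp add: ennreal_divide_times ennreal_times_divide)
      finally show ?thesis
        unfolding \<Delta>_def using fin[of x] by simp
    qed
  qed
  moreover have "\<Delta>' = \<Delta>" if "?P \<Delta>'" for \<Delta>'
  proof
    fix x
    have "ennreal (\<Delta>' x) * emeasure M E = ennreal (\<Delta> x) * emeasure M E"
      using that ex E by metis
    then have "ennreal (\<Delta>' x) = ennreal (\<Delta> x)"
      using emeasure_E by (metis ennreal_mult_divide_eq less_irrefl infinity_ennreal_def)
    then show "\<Delta>' x = \<Delta> x"
      using that ex by (metis ennreal_inj less_imp_le)
  qed
  ultimately have "?P (modular_function M)"
    unfolding modular_function_def by (rule theI)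
  with B show ?thesis
    by blast
qed

text \<open>Take the exchange formula with \<open>N = M\<close> and the indicators of
  \<open>E\<close> and \<open>B\<close>. Its right side integrates the mass of \<open>E - x\<close>
  over \<open>B\<close>; by \<open>emeasure_right_translate\<close> this mass is a multiple of the
  mass of \<open>E\<close>, which then cancels.\<close>

lemma emeasure_uminus_image:
  assumes B [measurable]: "B \<in> sets borel"
  shows "emeasure M (uminus ` B) = (\<integral>\<^sup>+y\<in>B. ennreal (modular_function M (- y)) \<partial>M)"
proof -
  have neg: "uminus ` B = uminus -` B"
    by (force simp: image_iff)
  have "uminus ` B \<in> sets borel"
    unfolding neg using measurable_sets[of uminus borel borel B] by simp
  then have "emeasure M (uminus ` B) = (\<integral>\<^sup>+y. indicator (uminus ` B) y \<partial>M)"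
    by (simp add: sets_M)
  also have "\<dots> = (\<integral>\<^sup>+y. indicator B (- y) \<partial>M)"
    unfolding neg by (intro nn_integral_cong) (auto simp: indicator_def)
  finally have 1: "emeasure M (uminus ` B) = (\<integral>\<^sup>+y. indicator B (- y) \<partial>M)" .
  have 2: "(\<integral>\<^sup>+y. indicator E (y + x) \<partial>M) = ennreal (modular_function M (- x)) * emeasure M E" for x
  proof -
    have "(\<integral>\<^sup>+y. indicator E (y + x) \<partial>M) = (\<integral>\<^sup>+y. indicator ((\<lambda>b. b - x) ` E) y \<partial>M)"
      using image_right_translate[of "- x" E]
      by (intro nn_integral_cong) (auto simp: indicator_def)
    also have "\<dots> = emeasure M ((\<lambda>b. b - x) ` E)"
      using right_translate_borel[OF E, of "- x"] by (intro nn_integral_indicator) (simp add: sets_M)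
    finally show ?thesis
      using emeasure_right_translate[OF E, of "- x"] by simp
  qed
  \<comment> \<open>Up to the constant mass of \<open>E\<close>, this function is the parametrised
    integral in fact \<open>2\<close>, and such integrals are measurable in the parameter.\<close>
  have [measurable]: "(\<lambda>x. ennreal (modular_function M (- x))) \<in> borel_measurable borel"
  proof -
    have "(\<lambda>x. ennreal (modular_function M (- x)))
        = (\<lambda>x. (\<integral>\<^sup>+y. indicator E (y + x) \<partial>M) / emeasure M E)"
      unfolding 2 using emeasure_E by (simp add: ennreal_mult_divide_eq)
    also have "\<dots> \<in> borel_measurable borel"
      by measurable
    finally show ?thesis .
  qed
  have "emeasure M E * emeasure M (uminus ` B)
      = (\<integral>\<^sup>+x. indicator B x * (ennreal (modular_function M (- x)) * emeasure M E) \<partial>M)"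
    using nn_integral_left_invariant_exchange[OF left_invariant_measure_axioms
        left_invariant_measure_axioms, of "indicator E" "indicator B"]
    by (simp add: 1 2 sets_M)
  also have "\<dots> = (\<integral>\<^sup>+y\<in>B. ennreal (modular_function M (- y)) \<partial>M) * emeasure M E"
    by (subst nn_integral_multc[symmetric]) (auto simp: mult_ac)
  finally have "emeasure M (uminus ` B) * emeasure M E / emeasure M E
      = (\<integral>\<^sup>+y\<in>B. ennreal (modular_function M (- y)) \<partial>M) * emeasure M E / emeasure M E"
    by (simp only: mult.commute)
  then show ?thesis
    using emeasure_E by (simp add: ennreal_mult_divide_eq)
qed

end

section \<open>Jensen's inequality for extended nonnegative functions\<close>

lemma epowr_1 [simp]: "epowr x 1 = x"
  by (cases x) (auto simp: epowr_def)

lemma epowr_0 [simp]: "epowr x 0 = 1"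
  by (simp add: epowr_def)

lemma epowr_top [simp]: "a \<noteq> 0 \<Longrightarrow> epowr top a = top"
  by (simp add: epowr_def)

lemma epowr_ennreal: "0 \<le> x \<Longrightarrow> a \<noteq> 0 \<Longrightarrow> epowr (ennreal x) a = ennreal (x powr a)"
  by (simp add: epowr_def)

lemma epowr_zero [simp]: "a \<noteq> 0 \<Longrightarrow> epowr 0 a = 0"
  by (simp add: epowr_def)

lemma epowr_mono:
  assumes "0 \<le> a" "x \<le> y"
  shows "epowr x a \<le> epowr y a"
proof (cases "a = 0")
  case False
  with assms show ?thesis
    by (cases x; cases y) (auto simp: epowr_ennreal top_unique intro!: ennreal_leI powr_mono2)
qed simp

lemma epowr_mult:
  assumes "0 \<le> a"
  shows "epowr (x * y) a = epowr x a * epowr y a"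
proof (cases "a = 0")
  case False
  have top: "epowr (top * z) a = top * epowr z a" for z
    using False by (cases z) (auto simp: epowr_ennreal ennreal_mult_top ennreal_top_mult)
  show ?thesis
  proof (cases x)
    case (real r)
    then show ?thesis
      using False top[of x]
      by (cases y) (auto simp: epowr_ennreal powr_mult ennreal_mult mult.commute simp flip: ennreal_mult)
  qed (simp add: top False)
qed simp

lemma epowr_epowr:
  assumes "0 \<le> a" "0 \<le> b"
  shows "epowr (epowr x a) b = epowr x (a * b)"
proof (cases "a = 0 \<or> b = 0")
  case True
  have "epowr 1 b = 1"
    by (cases "b = 0") (simp_all add: epowr_ennreal flip: ennreal_1)
  with True show ?thesis
    by auto
next
  case False
  then show ?thesis
    by (cases x) (auto simp: epowr_ennreal powr_powr)
qed

lemma measurable_epowr [measurable (raw)]: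
  assumes [measurable]: "f \<in> borel_measurable M"
  shows "(\<lambda>x. epowr (f x) a) \<in> borel_measurable M"
  unfolding epowr_def by measurable

lemma epowr_young:
  assumes "1 < s" "0 \<le> c"
  shows "ennreal (s * c powr (s - 1)) * x \<le> epowr x s + ennreal ((s - 1) * c powr s)"
proof (cases x)
  case (real y)
  have "y * c powr (s - 1) \<le> y powr s / s + (c powr (s - 1)) powr (s / (s - 1)) / (s / (s - 1))"
    using assms real by (intro Youngs_inequality) (auto simp: field_simps)
  also have "(c powr (s - 1)) powr (s / (s - 1)) = c powr s"
    using assms by (simp add: powr_powr)
  finally have "s * c powr (s - 1) * y \<le> y powr s + (s - 1) * c powr s"
    using assms by (simp add: field_simps)
  then have "ennreal (s * c powr (s - 1) * y) \<le> ennreal (y powr s + (s - 1) * c powr s)"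
    by (rule ennreal_leI)
  then show ?thesis
    using assms real by (simp add: epowr_ennreal ennreal_mult ennreal_plus)
next
  case top
  then show ?thesis
    using assms by simp
qed

text \<open>Integrate the tangent inequality at \<open>c\<close> and let the point of tangency
  \<open>c\<close> be the mean of \<open>h\<close>. A power of the total mass remains because the
  measure is not normalised.\<close>

lemma epowr_nn_integral_le:
  assumes [measurable]: "h \<in> borel_measurable N" and s: "1 \<le> s"
    and N: "0 < emeasure N (space N)" "emeasure N (space N) < \<infinity>"
  shows "epowr (\<integral>\<^sup>+x. h x \<partial>N) s \<le> epowr (emeasure N (space N)) (s - 1) * (\<integral>\<^sup>+x. epowr (h x) s \<partial>N)"
proof (cases "s = 1")
  case False
  then have s: "1 < s"
    using s by simp
  obtain m where m: "emeasure N (space N) = ennreal m" "0 < m"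
    using N by (cases "emeasure N (space N)") auto
  show ?thesis
  proof (cases "\<integral>\<^sup>+x. epowr (h x) s \<partial>N")
    case (real J)
    have int: "ennreal (s * c powr (s - 1)) * (\<integral>\<^sup>+x. h x \<partial>N)
        \<le> ennreal J + ennreal ((s - 1) * c powr s * m)" if "0 \<le> c" for c
    proof -
      have "ennreal (s * c powr (s - 1)) * (\<integral>\<^sup>+x. h x \<partial>N)
          = (\<integral>\<^sup>+x. ennreal (s * c powr (s - 1)) * h x \<partial>N)"
        by (simp add: nn_integral_cmult)
      also have "\<dots> \<le> (\<integral>\<^sup>+x. epowr (h x) s + ennreal ((s - 1) * c powr s) \<partial>N)"
        by (intro nn_integral_mono epowr_young s that)
      also have "\<dots> = ennreal J + ennreal ((s - 1) * c powr s) * ennreal m"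
        using real m by (simp add: nn_integral_add)
      also have "ennreal ((s - 1) * c powr s) * ennreal m = ennreal ((s - 1) * c powr s * m)"
        using s m by (intro ennreal_mult[symmetric]) auto
      finally show ?thesis .
    qed
    \<comment> \<open>The choice \<open>c = 1\<close> shows that the integral of \<open>h\<close> is
      finite; only then can its mean serve as \<open>c\<close>.\<close>
    have "ennreal s * (\<integral>\<^sup>+x. h x \<partial>N) < top"
      using int[of 1] s by (simp add: less_top[symmetric]) (metis ennreal_add_eq_top ennreal_neq_top top_unique)
    then obtain H where H: "(\<integral>\<^sup>+x. h x \<partial>N) = ennreal H" "0 \<le> H"
      using s by (cases "\<integral>\<^sup>+x. h x \<partial>N") (auto simp: ennreal_mult_top)
    define c where "c = H / m"
    have c: "0 \<le> c" "H = c * m"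
      using H m by (auto simp: c_def)
    have "ennreal (s * c powr (s - 1) * H) \<le> ennreal (J + (s - 1) * c powr s * m)"
      using int[OF c(1)] H s c m real by (simp add: ennreal_mult ennreal_plus)
    then have "s * c powr (s - 1) * H \<le> J + (s - 1) * c powr s * m"
      using s m real by (subst (asm) ennreal_le_iff) auto
    moreover have "s * c powr (s - 1) * H = s * (c powr s * m)"
      using c s by (cases "c = 0") (auto simp: powr_diff)
    moreover have "(s - 1) * c powr s * m = s * (c powr s * m) - c powr s * m"
      by (simp add: algebra_simps)
    ultimately have "c powr s * m \<le> J"
      by linarith
    then have "m powr (s - 1) * (c powr s * m) \<le> m powr (s - 1) * J"
      by (intro mult_left_mono) auto
    moreover have "H powr s = m powr (s - 1) * (c powr s * m)"
      using c m by (simp add: powr_mult powr_diff)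
    ultimately show ?thesis
      using H m real s by (simp add: epowr_ennreal flip: ennreal_mult)
  next
    case top
    then show ?thesis
      using m s by (simp add: epowr_ennreal ennreal_mult_top)
  qed
qed simp

text \<open>The preceding estimate is applied to the restriction of \<open>N\<close> to
  \<open>B\<close> and rescaled. If \<open>B\<close> has measure 0 or \<infinity>, the average on
  the left is 0 by the conventions for division.\<close>

lemma epowr_set_average_le:
  assumes [measurable]: "h \<in> borel_measurable N" "B \<in> sets N" and s: "1 \<le> s"
  shows "epowr ((\<integral>\<^sup>+x\<in>B. h x \<partial>N) / emeasure N B) s \<le> (\<integral>\<^sup>+x\<in>B. epowr (h x) s \<partial>N) / emeasure N B"
proof (cases "emeasure N B")
  case (real m)
  show ?thesis
  proof (cases "m = 0")
    case True
    then have "(\<integral>\<^sup>+x\<in>B. h x \<partial>N) = 0"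
      using real nn_integral_null_set[of B N h] by (auto simp: null_sets_def)
    then show ?thesis
      using s by simp
  next
    case False
    then have m: "0 < m"
      using real by simp
    let ?N = "density N (indicator B)"
    have "emeasure ?N (space ?N) = ennreal m"
      using real sets.sets_into_space[of B N] by (simp add: emeasure_density Int_absorb1 Int_absorb2)
    then have "epowr (\<integral>\<^sup>+x. h x \<partial>?N) s \<le> epowr (ennreal m) (s - 1) * (\<integral>\<^sup>+x. epowr (h x) s \<partial>?N)"
      using epowr_nn_integral_le[of h ?N s] m s by simp
    then have *: "epowr (\<integral>\<^sup>+x\<in>B. h x \<partial>N) s \<le> epowr (ennreal m) (s - 1) * (\<integral>\<^sup>+x\<in>B. epowr (h x) s \<partial>N)"
      by (simp add: nn_integral_density mult.commute)
    have "epowr (ennreal (1 / m)) s * epowr (ennreal m) (s - 1) = ennreal (1 / m)"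
      using m s by (cases "s = 1")
        (auto simp: epowr_ennreal powr_divide powr_diff simp flip: ennreal_mult)
    moreover have div: "z / ennreal m = ennreal (1 / m) * z" for z
      using m by (simp add: divide_ennreal_def inverse_ennreal inverse_eq_divide mult.commute)
    ultimately show ?thesis
      using mult_left_mono[OF *, of "epowr (ennreal (1 / m)) s"] s
      unfolding real div by (simp add: epowr_mult mult.assoc[symmetric])
  qed
qed (use s in simp)

section \<open>The bound for averages over translates of a fixed family of sets\<close>

context left_invariant_measure
begin

lemma emeasure_translated_preimage:
  assumes "B \<in> sets borel"
  shows "emeasure M {y. - x + y \<in> B} = emeasure M B"
proof -
  have "{y. - x + y \<in> B} = (+) x ` B"
    by (force simp: image_iff add.assoc[symmetric])
  then show ?thesis
    using emeasure_translate[OF assms] by simp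
qed

end

text \<open>
  This is \<^term>\<open>weight_measure w\<close> extended by zero to the Borel sets of the whole line.
\<close>

definition radius_measure :: "(real \<Rightarrow> real) \<Rightarrow> real measure" where
  "radius_measure w = density lborel (\<lambda>r. ennreal (w r) * indicator {0<..} r)"

section \<open>The weight as a finite measure on the real line\<close>

context
  fixes w :: "real \<Rightarrow> real"
  assumes w: "radius_weight w"
begin

lemma measurable_radius_weight [measurable]:
  "(\<lambda>r. ennreal (w r) * indicator {0<..} r) \<in> borel_measurable borel"
proof -
  have "w \<in> borel_measurable (restrict_space borel {0<..})"
    using w by (simp add: radius_weight_def)
  then have "(\<lambda>r. ennreal (w r)) \<in> borel_measurable (restrict_space borel {0<..})"
    by (rule measurable_compose[OF _ measurable_ennreal])
  then show ?thesis
    by (subst (asm) borel_measurable_restrict_space_iff_ennreal) (auto simp: mult.commute)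
qed

lemma sets_radius_measure [measurable_cong]: "sets (radius_measure w) = sets borel"
  and space_radius_measure [simp]: "space (radius_measure w) = UNIV"
  by (simp_all add: radius_measure_def)

lemma nn_integral_radius_measure:
  assumes [measurable]: "u \<in> borel_measurable borel"
  shows "(\<integral>\<^sup>+r. u r \<partial>radius_measure w) = (\<integral>\<^sup>+r\<in>{0<..}. ennreal (w r) * u r \<partial>lborel)"
  unfolding radius_measure_def by (subst nn_integral_density) (auto simp: mult_ac)

lemma emeasure_radius_measure: "emeasure (radius_measure w) (space (radius_measure w)) = weight_norm w"
  using nn_integral_radius_measure[of "\<lambda>_. 1"] by (simp add: weight_norm_def)

text \<open>Mass zero would make \<open>w\<close> vanish almost everywhere on the unit interval,
  which is not a null set. Jensen's inequality requires positive mass in order to form a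
  mean.\<close>

lemma weight_norm_pos: "0 < weight_norm w"
proof (rule ccontr)
  assume "\<not> 0 < weight_norm w"
  then have "AE r in lborel. ennreal (w r) * indicator {0<..} r = 0"
    by (subst nn_integral_0_iff_AE[symmetric]) (auto simp: weight_norm_def)
  moreover have "AE r in lborel. 0 < r \<longrightarrow> w r \<noteq> 0"
    using w by (simp add: radius_weight_def)
  ultimately have "AE r in lborel. \<not> (0 < r \<and> r < (1 :: real))"
  proof eventually_elim
    case (elim r)
    then show ?case
      using w by (auto simp: radius_weight_def indicator_def ennreal_eq_0_iff intro: antisym)
  qed
  then have "AE r in lborel. r \<notin> {0<..<1 :: real}"
    by simp
  then have "{0<..<1 :: real} \<in> null_sets lborel"
    by (subst AE_iff_null_sets) auto
  then show False
    by (simp add: null_sets_def)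
qed

lemma finite_radius_measure: "finite_measure (radius_measure w)"
  using w emeasure_radius_measure by (intro finite_measureI) (auto simp: radius_weight_def)

text \<open>For \<open>p = \<infinity>\<close>, \<open>I_op\<close> refers to
  \<open>weight_measure w\<close>, whose space is the open half-line. The essential supremum of a
  measurable function depends on null sets only, so \<open>radius_measure w\<close> can take
  over.\<close>

lemma AE_radius_measure:
  "(AE r in weight_measure w. P r) \<longleftrightarrow> (AE r in radius_measure w. P r)"
proof -
  have "w \<in> borel_measurable (restrict_space lborel {0<..})"
    using w unfolding radius_weight_def
    by (simp add: measurable_cong_sets[OF sets_restrict_space_cong[OF sets_lborel] refl])
  then have *: "(\<lambda>r. ennreal (w r)) \<in> borel_measurable (restrict_space lborel {0<..})"
    by (rule measurable_compose[OF _ measurable_ennreal])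
  have **: "(\<lambda>r. ennreal (w r) * indicator {0<..} r) \<in> borel_measurable lborel"
    by measurable
  show ?thesis
    unfolding weight_measure_def radius_measure_def AE_density[OF *] AE_density[OF **]
    by (auto simp: AE_restrict_space_iff indicator_def elim!: eventually_mono)
qed

lemma esssup_weight_measure_le_iff:
  fixes u :: "real \<Rightarrow> ennreal"
  assumes [measurable]: "u \<in> borel_measurable borel"
  shows "esssup (weight_measure w) u \<le> y \<longleftrightarrow> (AE r in radius_measure w. u r \<le> y)"
proof
  assume "esssup (weight_measure w) u \<le> y"
  then have "AE r in weight_measure w. u r \<le> y"
    using esssup_AE[of u "weight_measure w"] by (auto elim!: eventually_mono)
  then show "AE r in radius_measure w. u r \<le> y"
    by (simp add: AE_radius_measure)
next
  assume "AE r in radius_measure w. u r \<le> y"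
  then have "AE r in weight_measure w. u r \<le> y"
    by (simp add: AE_radius_measure)
  then show "esssup (weight_measure w) u \<le> y"
    by (intro esssup_I) (auto simp: weight_measure_def measurable_restrict_space1)
qed

end

text \<open>The geometry enters only through \<delta>, the distance from the identity, whose
  translated sublevel sets are the balls. Measurability of \<delta> passes to the volumes and,
  jointly in centre and radius, to the averages, as Fubini requires.\<close>

lemma (in haar_measure) I_op_Lq_bound:
  fixes A :: "('g, 'n::finite) chart set"
  assumes \<delta> [measurable]: "\<delta> \<in> borel_measurable borel"
    and ball: "\<And>x r. rball A g x r = {y. \<delta> (- x + y) < ennreal r}"
    and w: "radius_weight w"
    and f [measurable]: "f \<in> borel_measurable M"
    and p: "1 \<le> p" "p \<le> q"
  shows "Lq_norm M q (I_op A g M p w f)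
    \<le> epowr (weight_norm w) (weight_exponent p q)
      * epowr (weight_G_norm A g M w) (recip_exponent q)
      * Lq_norm M q (\<lambda>x. ennreal \<bar>f x\<bar>)"
proof -
  note [measurable_cong] = sets_radius_measure[OF w]
  define W where "W = radius_measure w"
  define F where "F x = ennreal \<bar>f x\<bar>" for x
  have F_eq: "F = (\<lambda>x. ennreal \<bar>f x\<bar>)"
    by (simp add: F_def fun_eq_iff)
  define V where "V r = emeasure M (rball A g 0 r)" for r
  define avg where "avg = ball_average A g M f"
  have [measurable]: "F \<in> borel_measurable borel"
    unfolding F_def using f by (simp add: measurable_cong_sets[OF sets_M refl])
  interpret W: finite_measure W
    unfolding W_def by (rule finite_radius_measure[OF w])
  interpret MW: pair_sigma_finite M W ..
  have [measurable_cong]: "sets W = sets borel"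
    unfolding W_def by (rule sets_radius_measure[OF w])
  have [measurable]: "{y. \<delta> (- x + y) < ennreal r} \<in> sets borel" for x r
    by measurable
  have ball_sets [measurable]: "rball A g x r \<in> sets borel" for x r
    unfolding ball by measurable
  have ball_V: "emeasure M (rball A g x r) = V r" for x r
    using emeasure_translated_preimage[of "{y. \<delta> y < ennreal r}" x] unfolding V_def ball by simp
  \<comment> \<open>Here, and for \<open>avg\<close> and \<open>G\<close> below, the ball becomes a
    condition on \<delta> inside the integrand, so that measurability follows from that of
    parametrised integrals.\<close>
  have V: "V r = (\<integral>\<^sup>+y. (if \<delta> y < ennreal r then 1 else 0) \<partial>M)" for r
  proof -
    have "V r = (\<integral>\<^sup>+y. indicator (rball A g 0 r) y \<partial>M)"
      unfolding V_def by (simp add: sets_M)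
    then show ?thesis
      by (simp add: ball indicator_def of_bool_def)
  qed
  have [measurable]: "V \<in> borel_measurable borel"
    unfolding V by measurable
  have avg: "avg x r = (\<integral>\<^sup>+y. (if \<delta> (- x + y) < ennreal r then F y else 0) \<partial>M) / V r" for x r
    unfolding avg_def ball_average_def ball_V
    by (auto simp: ball indicator_def F_def intro!: arg_cong2[where f = "(/)"] nn_integral_cong)
  have avg_meas [measurable]: "(\<lambda>(x, r). avg x r) \<in> borel_measurable (borel \<Otimes>\<^sub>M borel)"
    unfolding avg by measurable
  have avg_r [measurable]: "avg x \<in> borel_measurable borel" for x
    unfolding avg by measurable
  show ?thesis
  proof (cases "q = \<infinity>")
    case q: True
    let ?C = "esssup M F"
    have "AE y in M. F y \<le> ?C"
      by (rule esssup_AE)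
    then have avg_le: "avg x r \<le> ?C" for x r
    proof -
      have "(\<integral>\<^sup>+y\<in>rball A g x r. F y \<partial>M) \<le> (\<integral>\<^sup>+y\<in>rball A g x r. ?C \<partial>M)"
        using \<open>AE y in M. F y \<le> ?C\<close>
        by (intro nn_integral_mono_AE) (auto elim!: eventually_mono intro!: mult_right_mono)
      also have "\<dots> = ?C * V r"
        by (simp add: nn_integral_cmult_indicator sets_M ball_V)
      finally have "avg x r \<le> ?C * V r / V r"
        unfolding avg_def ball_average_def ball_V F_def by (rule divide_right_mono_ennreal)
      \<comment> \<open>If \<open>V r\<close> is 0 or \<infinity>, the quotient is 0.\<close>
      also have "\<dots> \<le> ?C"
        by (cases "V r = 0 \<or> V r = top") (auto simp: ennreal_mult_divide_eq)
      finally show ?thesis .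
    qed
    show ?thesis
    proof (cases "p = \<infinity>")
      case True
      have "I_op A g M p w f = (\<lambda>x. esssup (weight_measure w) (avg x))"
        unfolding I_op_def avg_def using True by simp
      \<comment> \<open>\<open>esssup\<close> takes the value \<open>top\<close> on functions that
        are not measurable, so measurability has to be proved. The sublevel sets are described by
        the vanishing of an integral over \<open>r\<close> that is measurable in
        \<open>x\<close>.\<close>
      moreover have "(\<lambda>x. esssup (weight_measure w) (avg x)) \<in> borel_measurable M"
      proof (rule borel_measurableI_le)
        fix y
        have "esssup (weight_measure w) (avg x) \<le> y
            \<longleftrightarrow> (\<integral>\<^sup>+r. (if y < avg x r then 1 else 0) \<partial>W) = 0" for x
          unfolding esssup_weight_measure_le_iff[OF w avg_r] W_def[symmetric]
          by (subst nn_integral_0_iff_AE) (auto intro!: AE_cong)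
        then show "{x \<in> space M. esssup (weight_measure w) (avg x) \<le> y} \<in> sets M"
          by simp
      qed
      moreover have "esssup (weight_measure w) (avg x) \<le> ?C" for x
        unfolding esssup_weight_measure_le_iff[OF w avg_r] using avg_le by simp
      ultimately have "esssup M (I_op A g M p w f) \<le> ?C"
        by (auto intro!: esssup_I)
      then show ?thesis
        using q True by (simp add: Lq_norm_def weight_exponent_def recip_exponent_def F_eq)
    next
      case False
      define P where "P = enn2real p"
      have P: "1 \<le> P"
        using p False unfolding P_def by (cases p) auto
      have "I_op A g M p w f = (\<lambda>x. epowr (\<integral>\<^sup>+r. epowr (avg x r) P \<partial>W) (1 / P))"
        unfolding I_op_def avg_def[symmetric] P_def[symmetric] W_def using False
        by (simp add: nn_integral_radius_measure[OF w])
      moreover have "(\<lambda>x. epowr (\<integral>\<^sup>+r. epowr (avg x r) P \<partial>W) (1 / P)) \<in> borel_measurable M"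
        by measurable
      moreover have "epowr (\<integral>\<^sup>+r. epowr (avg x r) P \<partial>W) (1 / P) \<le> epowr (weight_norm w) (1 / P) * ?C" for x
      proof -
        have "(\<integral>\<^sup>+r. epowr (avg x r) P \<partial>W) \<le> (\<integral>\<^sup>+r. epowr ?C P \<partial>W)"
          using P avg_le by (intro nn_integral_mono epowr_mono) auto
        also have "\<dots> = weight_norm w * epowr ?C P"
          using emeasure_radius_measure[OF w] by (simp add: W_def mult.commute)
        finally show ?thesis
          using epowr_mono[of "1 / P"] P by (fastforce simp: epowr_mult epowr_epowr)
      qed
      ultimately have "esssup M (I_op A g M p w f) \<le> epowr (weight_norm w) (1 / P) * ?C"
        by (auto intro!: esssup_I)
      then show ?thesis
        using q False by (simp add: Lq_norm_def weight_exponent_def recip_exponent_def F_eq P_def)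
    qed
  next
    case q: False
    define P where "P = enn2real p"
    define Q where "Q = enn2real q"
    have p_fin: "p \<noteq> \<infinity>"
      using p q by (auto simp: top_unique)
    have P: "1 \<le> P"
      using p p_fin unfolding P_def by (cases p) auto
    have PQ: "P \<le> Q"
      using p q unfolding P_def Q_def by (auto intro!: enn2real_mono simp: less_top)
    \<comment> \<open>\<open>G r\<close> is the volume of the inverted ball, in other words the
      inner integral of \<open>weight_G_norm\<close>.\<close>
    define G where "G r = (\<integral>\<^sup>+y. (if \<delta> (- y) < ennreal r then 1 else 0) \<partial>M)" for r
    have [measurable]: "G \<in> borel_measurable borel"
      unfolding G_def by measurable
    have G: "G r = (\<integral>\<^sup>+y\<in>rball A g 0 r. ennreal (modular_function M (- y)) \<partial>M)" for r
    proof -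
      have "uminus ` rball A g 0 r = {y. \<delta> (- y) < ennreal r}"
        unfolding ball by (force simp: image_iff)
      then have "emeasure M (uminus ` rball A g 0 r) = (\<integral>\<^sup>+y. indicator {y. \<delta> (- y) < ennreal r} y \<partial>M)"
        by (simp add: sets_M)
      also have "\<dots> = G r"
        unfolding G_def by (simp add: indicator_def of_bool_def)
      finally show ?thesis
        using emeasure_uminus_image[OF ball_sets] by simp
    qed
    have WG: "weight_G_norm A g M w = (\<integral>\<^sup>+r. G r / V r \<partial>W)"
      unfolding weight_G_norm_def G[symmetric] V_def[symmetric] W_def
      by (simp add: nn_integral_radius_measure[OF w] ennreal_divide_times)
    let ?Fq = "\<integral>\<^sup>+y. epowr (F y) Q \<partial>M"
    have avg_int: "(\<integral>\<^sup>+x. epowr (avg x r) Q \<partial>M) \<le> ?Fq * (G r / V r)" for r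
    proof -
      have "(\<integral>\<^sup>+x. epowr (avg x r) Q \<partial>M)
          \<le> (\<integral>\<^sup>+x. (\<integral>\<^sup>+y. (if \<delta> (- x + y) < ennreal r then epowr (F y) Q else 0) \<partial>M) / V r \<partial>M)"
      proof (rule nn_integral_mono)
        fix x
        have "epowr (avg x r) Q \<le> (\<integral>\<^sup>+y\<in>rball A g x r. epowr (F y) Q \<partial>M) / V r"
          using epowr_set_average_le[of F M "rball A g x r" Q] P PQ
          by (simp add: avg_def ball_average_def F_def ball_V sets_M)
        also have "\<dots> = (\<integral>\<^sup>+y. (if \<delta> (- x + y) < ennreal r then epowr (F y) Q else 0) \<partial>M) / V r"
          by (auto simp: ball indicator_def intro!: arg_cong2[where f = "(/)"] nn_integral_cong)
        finally show "epowr (avg x r) Q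
            \<le> (\<integral>\<^sup>+y. (if \<delta> (- x + y) < ennreal r then epowr (F y) Q else 0) \<partial>M) / V r" .
      qed
      also have "\<dots> = (\<integral>\<^sup>+x. \<integral>\<^sup>+y. (if \<delta> (- x + y) < ennreal r then epowr (F y) Q else 0) \<partial>M \<partial>M) / V r"
        by (rule nn_integral_divide) measurable
      also have "(\<integral>\<^sup>+x. \<integral>\<^sup>+y. (if \<delta> (- x + y) < ennreal r then epowr (F y) Q else 0) \<partial>M \<partial>M)
          = (\<integral>\<^sup>+y. \<integral>\<^sup>+x. (if \<delta> (- x + y) < ennreal r then epowr (F y) Q else 0) \<partial>M \<partial>M)"
      proof -
        interpret pair_sigma_finite M M ..
        show ?thesis
          by (rule Fubini') measurable
      qed
      also have "\<dots> = (\<integral>\<^sup>+y. epowr (F y) Q * G r \<partial>M)"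
      proof (rule nn_integral_cong)
        fix y
        have "(\<integral>\<^sup>+x. (if \<delta> (- x + y) < ennreal r then epowr (F y) Q else 0) \<partial>M)
            = (\<integral>\<^sup>+x. epowr (F y) Q * (if \<delta> (- x + y) < ennreal r then 1 else 0) \<partial>M)"
          by (auto intro!: nn_integral_cong)
        also have "\<dots> = epowr (F y) Q * (\<integral>\<^sup>+x. (if \<delta> (- x + y) < ennreal r then 1 else 0) \<partial>M)"
          by (rule nn_integral_cmult) measurable
        \<comment> \<open>The substitution \<open>x \<mapsto> y + x\<close> removes
          \<open>y\<close>, because \<open>- (y + x) + y = - x\<close>.\<close>
        also have "(\<integral>\<^sup>+x. (if \<delta> (- x + y) < ennreal r then 1 else 0) \<partial>M) = G r"
          using nn_integral_translate[of "\<lambda>x. if \<delta> (- x + y) < ennreal r then 1 else 0" y]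
          by (simp add: G_def minus_add add.assoc)
        finally show "(\<integral>\<^sup>+x. (if \<delta> (- x + y) < ennreal r then epowr (F y) Q else 0) \<partial>M)
          = epowr (F y) Q * G r" .
      qed
      also have "\<dots> / V r = ?Fq * (G r / V r)"
        by (simp add: nn_integral_multc ennreal_times_divide)
      finally show ?thesis .
    qed
    let ?m = "weight_norm w"
    have I: "I_op A g M p w f = (\<lambda>x. epowr (\<integral>\<^sup>+r. epowr (avg x r) P \<partial>W) (1 / P))"
      unfolding I_op_def avg_def[symmetric] P_def[symmetric] W_def using p_fin
      by (simp add: nn_integral_radius_measure[OF w])
    have "(\<integral>\<^sup>+x. epowr (I_op A g M p w f x) Q \<partial>M)
        \<le> (\<integral>\<^sup>+x. epowr ?m (Q / P - 1) * (\<integral>\<^sup>+r. epowr (avg x r) Q \<partial>W) \<partial>M)"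
    proof (rule nn_integral_mono)
      fix x
      have "epowr (I_op A g M p w f x) Q = epowr (\<integral>\<^sup>+r. epowr (avg x r) P \<partial>W) (Q / P)"
        unfolding I using P PQ by (simp add: epowr_epowr)
      \<comment> \<open>Jensen is applied to the \<open>P\<close>-th powers of the averages with
        exponent \<open>Q / P\<close>. The mass exponent \<open>Q / P - 1\<close> becomes
        \<open>(Q - P) / (Q * P)\<close> when the \<open>Q\<close>-th root is taken at the
        end.\<close>
      also have "\<dots> \<le> epowr (emeasure W (space W)) (Q / P - 1) * (\<integral>\<^sup>+r. epowr (epowr (avg x r) P) (Q / P) \<partial>W)"
        using P PQ weight_norm_pos[OF w] W.emeasure_finite[of "space W"] emeasure_radius_measure[OF w]
        by (intro epowr_nn_integral_le) (auto simp: W_def less_top)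
      finally show "epowr (I_op A g M p w f x) Q
          \<le> epowr ?m (Q / P - 1) * (\<integral>\<^sup>+r. epowr (avg x r) Q \<partial>W)"
        using P PQ emeasure_radius_measure[OF w] by (simp add: epowr_epowr W_def)
    qed
    also have "\<dots> = epowr ?m (Q / P - 1) * (\<integral>\<^sup>+x. \<integral>\<^sup>+r. epowr (avg x r) Q \<partial>W \<partial>M)"
      by (rule nn_integral_cmult) measurable
    also have "(\<integral>\<^sup>+x. \<integral>\<^sup>+r. epowr (avg x r) Q \<partial>W \<partial>M) = (\<integral>\<^sup>+r. \<integral>\<^sup>+x. epowr (avg x r) Q \<partial>M \<partial>W)"
      by (rule MW.Fubini'[symmetric]) measurable
    also have "\<dots> \<le> (\<integral>\<^sup>+r. ?Fq * (G r / V r) \<partial>W)"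
      by (intro nn_integral_mono avg_int)
    also have "\<dots> = ?Fq * weight_G_norm A g M w"
      unfolding WG by (rule nn_integral_cmult) measurable
    finally have "(\<integral>\<^sup>+x. epowr (I_op A g M p w f x) Q \<partial>M)
        \<le> epowr ?m (Q / P - 1) * (?Fq * weight_G_norm A g M w)"
      by (simp add: mult_left_mono)
    then have "epowr (\<integral>\<^sup>+x. epowr (I_op A g M p w f x) Q \<partial>M) (1 / Q)
        \<le> epowr (epowr ?m (Q / P - 1) * (?Fq * weight_G_norm A g M w)) (1 / Q)"
      using P PQ by (intro epowr_mono) auto
    also have "\<dots> = epowr ?m ((Q / P - 1) * (1 / Q)) * (epowr ?Fq (1 / Q) * epowr (weight_G_norm A g M w) (1 / Q))"
      using P PQ by (simp add: epowr_mult epowr_epowr)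
    also have "(Q / P - 1) * (1 / Q) = (Q - P) / (Q * P)"
      using P PQ by (simp add: field_simps)
    finally show ?thesis
      using q by (simp add: Lq_norm_def weight_exponent_def recip_exponent_def F_eq P_def Q_def mult_ac)
  qed
qed

section \<open>Invariance of the Riemannian volume\<close>

context
  fixes c :: "('g::topological_space, 'n::finite) chart"
  assumes c: "is_chart c"
begin

lemma open_chart_dom: "open (chart_dom c)"
  and open_chart_im: "open (chart_im c)"
  using c by (auto simp: is_chart_def)

lemma continuous_on_chart_map: "continuous_on (chart_dom c) (chart_map c)"
  and continuous_on_chart_inv: "continuous_on (chart_im c) (chart_inv c)"
  using c by (auto simp: is_chart_def homeomorphism_def)

lemma chart_inv_map [simp]: "p \<in> chart_dom c \<Longrightarrow> chart_inv c (chart_map c p) = p"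
  and chart_map_inv [simp]: "u \<in> chart_im c \<Longrightarrow> chart_map c (chart_inv c u) = u"
  and chart_map_in_im [simp]: "p \<in> chart_dom c \<Longrightarrow> chart_map c p \<in> chart_im c"
  and chart_inv_in_dom [simp]: "u \<in> chart_im c \<Longrightarrow> chart_inv c u \<in> chart_dom c"
  using c by (auto simp: is_chart_def homeomorphism_def)

lemma chart_image_eq:
  assumes "B \<subseteq> chart_dom c"
  shows "chart_map c ` B = {u \<in> chart_im c. chart_inv c u \<in> B}"
  using assms by (force simp: image_iff)

lemma open_chart_vimage:
  assumes "open V"
  shows "open {p \<in> chart_dom c. chart_map c p \<in> V}"
  using continuous_open_preimage[OF continuous_on_chart_map open_chart_dom assms]
  by (simp add: vimage_def Int_def)

lemma open_chart_inv_vimage: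
  assumes "open V"
  shows "open {u \<in> chart_im c. chart_inv c u \<in> V}"
  using continuous_open_preimage[OF continuous_on_chart_inv open_chart_im assms]
  by (simp add: vimage_def Int_def)

lemma borel_chart_image:
  assumes "B \<in> sets borel" "B \<subseteq> chart_dom c"
  shows "chart_map c ` B \<in> sets borel"
proof -
  have "chart_inv c -` B \<inter> space (restrict_space borel (chart_im c)) \<in> sets (restrict_space borel (chart_im c))"
    by (rule measurable_sets[OF borel_measurable_continuous_on_restrict[OF continuous_on_chart_inv] assms(1)])
  moreover have "chart_inv c -` B \<inter> space (restrict_space borel (chart_im c)) = chart_map c ` B"
    using chart_image_eq[OF assms(2)] by (auto simp: space_restrict_space)
  ultimately show ?thesis
    using borel_open[OF open_chart_im] by (auto simp: sets_restrict_space)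
qed

end

text \<open>On the segment from the identity to \<open>H\<close> the quadratic form stays positive,
  so no matrix on it is singular. The determinant is continuous along the segment and starts at 1,
  hence it cannot change sign.\<close>

lemma det_pos_if_pos_def:
  fixes H :: "real ^ 'n ^ 'n"
  assumes H: "\<And>u. u \<noteq> 0 \<Longrightarrow> 0 < u \<bullet> (H *v u)"
  shows "0 < det H"
proof (rule ccontr)
  assume "\<not> 0 < det H"
  define P where "P t = (1 - t) *\<^sub>R mat 1 + t *\<^sub>R H" for t
  have "continuous_on {0..1} (\<lambda>t. det (P t))"
    unfolding P_def det_def by (intro continuous_intros)
  moreover have "det (P 0) = 1" "det (P 1) = det H"
    by (simp_all add: P_def)
  ultimately obtain t where t: "0 \<le> t" "t \<le> 1" "det (P t) = 0"
    using IVT2'[of "\<lambda>t. det (P t)" 1 0 0] \<open>\<not> 0 < det H\<close> by auto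
  then have "\<not> invertible (P t)"
    using invertible_det_nz by metis
  then obtain u where u: "u \<noteq> 0" "P t *v u = 0"
    using invertible_left_inverse matrix_left_invertible_ker by metis
  have "(1 - t) * (u \<bullet> u) + t * (u \<bullet> (H *v u)) = u \<bullet> (P t *v u)"
    by (simp add: P_def matrix_vector_mult_add_rdistrib scaleR_matrix_vector_assoc[symmetric]
        inner_add_right)
  also have "\<dots> = 0"
    using u by simp
  finally have "(1 - t) * (u \<bullet> u) + t * (u \<bullet> (H *v u)) = 0" .
  moreover have "0 < u \<bullet> u" "0 < u \<bullet> (H *v u)"
    using u H by auto
  ultimately show False
    using t by (smt (verit) mult_nonneg_nonneg mult_pos_pos)
qed

text \<open>In matrix form the hypothesis reads \<open>transpose D ** H ** D = G\<close>; take
  determinants.\<close>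

lemma det_isometry:
  fixes G H :: "real ^ 'n ^ 'n"
  assumes "linear D" and "\<And>u v. D u \<bullet> (H *v D v) = u \<bullet> (G *v v)"
  shows "(det (matrix D))\<^sup>2 * det H = det G"
proof -
  let ?D = "matrix D"
  have "u \<bullet> ((transpose ?D ** H ** ?D) *v v) = u \<bullet> (G *v v)" for u v
  proof -
    have "u \<bullet> ((transpose ?D ** H ** ?D) *v v) = (?D *v u) \<bullet> (H *v (?D *v v))"
      by (metis (no_types, opaque_lifting) dot_lmul_matrix inner_commute matrix_vector_mul_assoc
          transpose_matrix_vector)
    then show ?thesis
      using assms by (simp add: matrix_works)
  qed
  then have "(transpose ?D ** H ** ?D) *v v = G *v v" for v
    by (metis vector_eq_rdot inner_commute)
  then have "transpose ?D ** H ** ?D = G"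
    using matrix_eq by blast
  then have "det (transpose ?D ** H ** ?D) = det G"
    by simp
  then show ?thesis
    by (simp add: det_mul power2_eq_square mult_ac)
qed

section \<open>Left translations read in charts\<close>

locale riemannian_lie_group =
  fixes A :: "('g::{topological_group_add, second_countable_topology, t2_space}, 'n::finite) chart set"
    and g :: "('g, 'n) metric_tensor"
  assumes lie_group: "lie_group A"
    and riemannian_metric: "riemannian_metric A g"
    and left_invariant_metric: "left_invariant_metric A g"
begin

lemma is_chart: "c \<in> A \<Longrightarrow> is_chart c"
  using lie_group by (simp add: lie_group_def smooth_structure_def)

lemma chart_around:
  obtains c where "c \<in> A" "p \<in> chart_dom c"
proof -
  have "(\<Union>c\<in>A. chart_dom c) = UNIV"
    using lie_group unfolding lie_group_def smooth_structure_def by blast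
  then show ?thesis
    using that by blast
qed

lemma continuous_translation: "continuous_on S ((+) (x :: 'g))"
  by (intro continuous_intros)

lemma open_translation_vimage: "open V \<Longrightarrow> open {p. (x :: 'g) + p \<in> V}"
  using open_vimage[OF _ continuous_translation[of UNIV]] by (simp add: vimage_def)

text \<open>For \<open>x = 0\<close> this is the change of charts, so that the two cases need no separate treatment.\<close>

definition transl :: "'g \<Rightarrow> ('g, 'n) chart \<Rightarrow> ('g, 'n) chart \<Rightarrow> real ^ 'n \<Rightarrow> real ^ 'n" where
  "transl x c c' u = chart_map c' (x + chart_inv c u)"

definition transl_dom :: "'g \<Rightarrow> ('g, 'n) chart \<Rightarrow> ('g, 'n) chart \<Rightarrow> (real ^ 'n) set" where
  "transl_dom x c c' = {u \<in> chart_im c. x + chart_inv c u \<in> chart_dom c'}"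

definition transl_deriv :: "'g \<Rightarrow> ('g, 'n) chart \<Rightarrow> ('g, 'n) chart \<Rightarrow> real ^ 'n \<Rightarrow> real ^ 'n \<Rightarrow> real ^ 'n" where
  "transl_deriv x c c' u = frechet_derivative (transl x c c') (at u)"

context
  fixes c c'
  assumes c: "c \<in> A" and c': "c' \<in> A"
begin

text \<open>In a chart \<open>a\<close> around \<open>x\<close>, translation by \<open>x\<close> is
  the group operation with its first argument frozen. Joint smoothness of the operation gives
  differentiability; the derivative is the partial one, the full derivative evaluated at
  \<open>(0, w)\<close>.\<close>

lemma
  shows transl_has_derivative:
      "u \<in> transl_dom x c c' \<Longrightarrow> (transl x c c' has_derivative transl_deriv x c c' u) (at u)"
    and continuous_on_transl_deriv: "continuous_on (transl_dom x c c') (\<lambda>u. transl_deriv x c c' u v)"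
proof -
  obtain a where a: "a \<in> A" "x \<in> chart_dom a"
    using chart_around .
  define H where "H = (\<lambda>(u, v). chart_map c' (chart_inv a u + chart_inv c v))"
  define W where "W = {(u, v). u \<in> chart_im a \<and> v \<in> chart_im c \<and> chart_inv a u + chart_inv c v \<in> chart_dom c'}"
  have "smooth_on H W"
    using lie_group a c c' unfolding lie_group_def H_def W_def by blast
  then have "Ck_on (Suc 0) H W"
    unfolding smooth_on_def by blast
  then have diff: "\<And>z. z \<in> W \<Longrightarrow> H differentiable (at z)"
    and cont: "\<And>v. continuous_on W (\<lambda>z. frechet_derivative H (at z) v)"
    by auto
  let ?u = "chart_map a x"
  have W: "(?u, v) \<in> W" if "v \<in> transl_dom x c c'" for v
    using that a is_chart[OF a(1)] by (auto simp: W_def transl_dom_def)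
  have eq: "transl x c c' = (\<lambda>v. H (?u, v))"
    using a is_chart[OF a(1)] by (auto simp: H_def transl_def)
  have der: "(transl x c c' has_derivative (\<lambda>w. frechet_derivative H (at (?u, v)) (0, w))) (at v)"
    if "v \<in> transl_dom x c c'" for v
    unfolding eq
    by (rule has_derivative_compose[of "\<lambda>v. (?u, v)" _ _ _ H])
      (auto intro!: derivative_eq_intros frechet_derivative_works[THEN iffD1] diff W that)
  then have eq': "transl_deriv x c c' v = (\<lambda>w. frechet_derivative H (at (?u, v)) (0, w))"
    if "v \<in> transl_dom x c c'" for v
    unfolding transl_deriv_def using frechet_derivative_at[OF der[OF that]] by simp
  show "(transl x c c' has_derivative transl_deriv x c c' u) (at u)" if "u \<in> transl_dom x c c'"
    using der eq' that by simp
  have "continuous_on (transl_dom x c c') (\<lambda>u. frechet_derivative H (at (?u, u)) (0, v))"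
    by (rule continuous_on_compose2[OF cont]) (auto intro!: continuous_intros W)
  then show "continuous_on (transl_dom x c c') (\<lambda>u. transl_deriv x c c' u v)"
    by (simp add: eq' cong: continuous_on_cong)
qed

lemma transl_deriv_isometric:
  assumes "p \<in> chart_dom c" "x + p \<in> chart_dom c'"
  shows "transl_deriv x c c' (chart_map c p) u \<bullet> (g c' (x + p) *v transl_deriv x c c' (chart_map c p) v)
    = u \<bullet> (g c p *v v)"
  using left_invariant_metric assms c c'
  unfolding left_invariant_metric_def isometric_at_def transl_deriv_def transl_def Let_def by blast

end

lemma chart_map_in_transl_dom:
  "c \<in> A \<Longrightarrow> p \<in> chart_dom c \<Longrightarrow> x + p \<in> chart_dom c' \<Longrightarrow> chart_map c p \<in> transl_dom x c c'"
  using is_chart by (simp add: transl_dom_def)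

lemma metric_pos: "c \<in> A \<Longrightarrow> p \<in> chart_dom c \<Longrightarrow> u \<noteq> 0 \<Longrightarrow> 0 < u \<bullet> (g c p *v u)"
  using riemannian_metric unfolding riemannian_metric_def by blast

lemma det_metric_pos: "c \<in> A \<Longrightarrow> p \<in> chart_dom c \<Longrightarrow> 0 < det (g c p)"
  by (intro det_pos_if_pos_def metric_pos)

lemma continuous_on_metric:
  assumes "c \<in> A"
  shows "continuous_on (chart_im c) (\<lambda>u. g c (chart_inv c u) $ i $ j)"
proof -
  have "smooth_on (\<lambda>u. g c (chart_inv c u) $ i $ j) (chart_im c)"
    using riemannian_metric assms unfolding riemannian_metric_def by blast
  then have "Ck_on 0 (\<lambda>u. g c (chart_inv c u) $ i $ j) (chart_im c)"
    unfolding smooth_on_def by blast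
  then show ?thesis
    by simp
qed

text \<open>The absolute value keeps the density nonnegative outside the image of the chart too,
  where nothing is known about the determinant and \<open>sqrt\<close> of a negative number is
  negative.\<close>

definition vol_density :: "('g, 'n) chart \<Rightarrow> real ^ 'n \<Rightarrow> real" where
  "vol_density c u = sqrt \<bar>det (g c (chart_inv c u))\<bar>"

lemma continuous_on_vol_density:
  assumes "c \<in> A"
  shows "continuous_on (chart_im c) (vol_density c)"
  unfolding vol_density_def[abs_def] det_def
  by (intro continuous_on_real_sqrt continuous_on_rabs continuous_on_sum continuous_on_mult
      continuous_on_const continuous_on_prod continuous_on_metric[OF assms])

lemma measurable_vol_density:
  assumes "c \<in> A" "S \<in> sets borel" "S \<subseteq> chart_im c"
  shows "(\<lambda>u. vol_density c u * indicator S u) \<in> borel_measurable borel"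
proof -
  have [measurable]: "(\<lambda>u. indicator (chart_im c) u *\<^sub>R vol_density c u) \<in> borel_measurable borel"
    using borel_measurable_continuous_on_indicator[OF _ continuous_on_vol_density[OF assms(1)]]
      open_chart_im[OF is_chart[OF assms(1)]] by simp
  note assms(2)[measurable]
  have "(\<lambda>u. (indicator (chart_im c) u *\<^sub>R vol_density c u) * indicator S u) \<in> borel_measurable borel"
    by measurable
  also have "(\<lambda>u. (indicator (chart_im c) u *\<^sub>R vol_density c u) * indicator S u)
      = (\<lambda>u. vol_density c u * indicator S u)"
    using assms(3) by (auto simp: indicator_def fun_eq_iff)
  finally show ?thesis .
qed

end

section \<open>The volume: invariance, positivity on open sets, finiteness on compact sets\<close>

locale riemannian_lie_group_volume = riemannian_lie_group A g
  for A :: "('g::{topological_group_add, second_countable_topology, t2_space}, 'n::finite) chart set"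
    and g :: "('g, 'n) metric_tensor" +
  fixes M :: "'g measure"
  assumes volume: "is_riemannian_volume A g M"
begin

lemma sets_volume: "sets M = sets borel"
  using volume by (simp add: is_riemannian_volume_def)

lemma emeasure_volume:
  assumes "c \<in> A" "B \<in> sets borel" "B \<subseteq> chart_dom c"
  shows "emeasure M B = (\<integral>\<^sup>+u\<in>chart_map c ` B. ennreal (vol_density c u) \<partial>lborel)"
proof -
  have "emeasure M B = (\<integral>\<^sup>+u\<in>chart_map c ` B. ennreal (sqrt (det (g c (chart_inv c u)))) \<partial>lborel)"
    using volume assms unfolding is_riemannian_volume_def by blast
  also have "\<dots> = (\<integral>\<^sup>+u\<in>chart_map c ` B. ennreal (vol_density c u) \<partial>lborel)"
  proof (rule nn_integral_cong)
    fix u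
    have "\<bar>det (g c (chart_inv c u))\<bar> = det (g c (chart_inv c u))" if "u \<in> chart_map c ` B"
      using that assms is_chart[OF assms(1)] det_metric_pos[OF assms(1), of "chart_inv c u"]
      by (auto simp: chart_image_eq)
    then show "ennreal (sqrt (det (g c (chart_inv c u)))) * indicator (chart_map c ` B) u
        = ennreal (vol_density c u) * indicator (chart_map c ` B) u"
      by (auto simp: indicator_def vol_density_def)
  qed
  finally show ?thesis .
qed

lemma translation_image_eq: "(+) x ` B = {y. - x + y \<in> B}" for x :: 'g
  by (force simp: image_iff add.assoc[symmetric])

lemma translation_image_borel:
  fixes x :: 'g
  assumes "B \<in> sets borel"
  shows "(+) x ` B \<in> sets borel"
  unfolding translation_image_eq using measurable_sets[of "(+) (- x)" borel borel B] assms
  by (simp add: vimage_def)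

text \<open>By \<open>det_isometry\<close>, the Gram determinants at \<open>p\<close> and
  \<open>x + p\<close> differ by the square of the Jacobian determinant of the translation in
  charts. The Jacobian factor in the change of variables therefore turns one density exactly into
  the other.\<close>

lemma emeasure_volume_translate_chart:
  assumes c: "c \<in> A" "c' \<in> A" and B: "B \<in> sets borel" "B \<subseteq> chart_dom c" "(+) x ` B \<subseteq> chart_dom c'"
  shows "emeasure M ((+) x ` B) = emeasure M B"
proof -
  note charts = is_chart[OF c(1)] is_chart[OF c(2)]
  let ?F = "transl x c c'" and ?S = "chart_map c ` B"
  have FS: "?F ` ?S = chart_map c' ` (+) x ` B"
    using B(2) charts by (force simp: transl_def image_iff)
  have S: "?S \<in> sets borel" "?F ` ?S \<in> sets borel"
    unfolding FS using B charts by (auto intro!: borel_chart_image translation_image_borel)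
  have S_im: "?S \<subseteq> chart_im c" "?F ` ?S \<subseteq> chart_im c'"
    unfolding FS using B charts by (auto simp: chart_image_eq)
  have S_dom: "u \<in> transl_dom x c c'" if "u \<in> ?S" for u
    using that B c by (auto intro!: chart_map_in_transl_dom)
  have transl_inv: "chart_inv c' (?F (chart_map c p)) = x + p \<and> chart_inv c (chart_map c p) = p"
    if "p \<in> B" for p
  proof -
    have "p \<in> chart_dom c" "x + p \<in> chart_dom c'"
      using that B by auto
    then show ?thesis
      using charts by (simp add: transl_def)
  qed
  have density: "\<bar>det (matrix (transl_deriv x c c' u))\<bar> * vol_density c' (?F u) = vol_density c u"
    if u: "u \<in> ?S" for u
  proof -
    obtain p where p: "p \<in> B" "u = chart_map c p"
      using u by auto
    have "linear (transl_deriv x c c' u)"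
      using transl_has_derivative[OF c S_dom[OF u]] has_derivative_linear by blast
    then have "(det (matrix (transl_deriv x c c' u)))\<^sup>2 * det (g c' (x + p)) = det (g c p)"
      unfolding p(2) by (rule det_isometry) (use p B c in \<open>auto intro!: transl_deriv_isometric\<close>)
    then have "\<bar>det (matrix (transl_deriv x c c' u))\<bar> * sqrt \<bar>det (g c' (x + p))\<bar> = sqrt \<bar>det (g c p)\<bar>"
      by (metis abs_mult abs_power2 real_sqrt_abs real_sqrt_mult)
    moreover have "chart_inv c' (?F u) = x + p" "chart_inv c u = p"
      using p transl_inv by auto
    ultimately show ?thesis
      by (simp add: vol_density_def)
  qed
  have "emeasure M ((+) x ` B) = (\<integral>\<^sup>+u\<in>?F ` ?S. ennreal (vol_density c' u) \<partial>lborel)"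
    unfolding FS by (intro emeasure_volume translation_image_borel c B)
  also have "\<dots> = (\<integral>\<^sup>+u\<in>?S. ennreal (\<bar>det (matrix (transl_deriv x c c' u))\<bar> * vol_density c' (?F u)) \<partial>lborel)"
  proof (rule nn_integral_change_of_variables[OF S])
    show "(?F has_derivative transl_deriv x c c' u) (at u)" if "u \<in> ?S" for u
      using transl_has_derivative[OF c S_dom[OF that]] .
    show "inj_on ?F ?S"
    proof (rule inj_onI)
      fix u v assume "u \<in> ?S" "v \<in> ?S" and *: "?F u = ?F v"
      then obtain p q where p: "p \<in> B" "u = chart_map c p" and q: "q \<in> B" "v = chart_map c q"
        by auto
      have "x + p = chart_inv c' (?F u)" "x + q = chart_inv c' (?F v)"
        using p q transl_inv by auto
      then have "x + p = x + q"
        unfolding * by metis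
      then show "u = v"
        using p q by auto
    qed
    show "0 \<le> vol_density c' u" for u
      by (simp add: vol_density_def)
    show "(\<lambda>u. vol_density c' u * indicator (?F ` ?S) u) \<in> borel_measurable borel"
      by (intro measurable_vol_density c S S_im)
    have "(\<lambda>u. \<bar>det (matrix (transl_deriv x c c' u))\<bar> * vol_density c' (?F u) * indicator ?S u)
        = (\<lambda>u. vol_density c u * indicator ?S u)"
      using density by (auto simp: indicator_def fun_eq_iff)
    then show "(\<lambda>u. \<bar>det (matrix (transl_deriv x c c' u))\<bar> * vol_density c' (?F u) * indicator ?S u)
        \<in> borel_measurable borel"
      using measurable_vol_density[OF c(1) S(1) S_im(1)] by simp
  qed
  also have "\<dots> = (\<integral>\<^sup>+u\<in>?S. ennreal (vol_density c u) \<partial>lborel)"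
    using density by (intro nn_integral_cong) (auto simp: indicator_def)
  also have "\<dots> = emeasure M B"
    by (intro emeasure_volume[symmetric] c B)
  finally show ?thesis .
qed

text \<open>Open sets that lie in a chart domain together with their translates cover the group.
  Countably many suffice by Lindelof; made disjoint, they cut \<open>B\<close> into pieces for the
  chart version.\<close>

lemma emeasure_volume_translate:
  assumes B: "B \<in> sets borel"
  shows "emeasure M ((+) x ` B) = emeasure M B"
proof -
  define K where "K = {W. open W \<and> (\<exists>c\<in>A. \<exists>c'\<in>A. W \<subseteq> chart_dom c \<and> (+) x ` W \<subseteq> chart_dom c')}"
  have "p \<in> \<Union>K" for p
  proof -
    obtain c c' where c: "c \<in> A" "p \<in> chart_dom c" "c' \<in> A" "x + p \<in> chart_dom c'"
      using chart_around by metis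
    let ?W = "chart_dom c \<inter> {q. x + q \<in> chart_dom c'}"
    have "open ?W"
      using c by (intro open_Int open_translation_vimage open_chart_dom is_chart)
    moreover have "?W \<subseteq> chart_dom c" "(+) x ` ?W \<subseteq> chart_dom c'"
      by blast+
    ultimately have "?W \<in> K"
      using c(1,3) unfolding K_def by blast
    then show ?thesis
      using c by blast
  qed
  moreover obtain K' where K': "K' \<subseteq> K" "countable K'" "\<Union>K' = \<Union>K"
    by (rule Lindelof[of K]) (auto simp: K_def)
  ultimately have "\<Union>K' = UNIV"
    by auto
  then have "K' \<noteq> {}"
    by auto
  define W where "W = from_nat_into K'"
  have W: "W i \<in> K" for i
    unfolding W_def using from_nat_into[OF \<open>K' \<noteq> {}\<close>, of i] K' by auto
  have W_UN: "(\<Union>i. W i) = UNIV"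
    unfolding W_def using range_from_nat_into[OF \<open>K' \<noteq> {}\<close> K'(2)] \<open>\<Union>K' = UNIV\<close> by simp
  define D where "D i = B \<inter> disjointed W i" for i
  have W_sets: "range W \<subseteq> sets borel"
    using W by (auto simp: K_def)
  have D_sets: "D i \<in> sets borel" for i
    unfolding D_def using sets.range_disjointed_sets[OF W_sets] B by blast
  have D_disj: "disjoint_family D"
    using disjoint_family_disjointed[of W] unfolding D_def disjoint_family_on_def by blast
  have D_UN: "(\<Union>i. D i) = B"
    unfolding D_def using UN_disjointed_eq[of W] W_UN by auto
  have "emeasure M ((+) x ` B) = emeasure M (\<Union>i. (+) x ` D i)"
    by (simp flip: D_UN add: image_UN)
  also have "\<dots> = (\<Sum>i. emeasure M ((+) x ` D i))"
  proof (rule suminf_emeasure[symmetric])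
    show "range (\<lambda>i. (+) x ` D i) \<subseteq> sets M"
      using D_sets translation_image_borel by (auto simp: sets_volume)
    show "disjoint_family (\<lambda>i. (+) x ` D i)"
      using D_disj by (fastforce simp: disjoint_family_on_def)
  qed
  also have "\<dots> = (\<Sum>i. emeasure M (D i))"
  proof (rule suminf_cong)
    fix i
    obtain c c' where "c \<in> A" "c' \<in> A" "W i \<subseteq> chart_dom c" "(+) x ` W i \<subseteq> chart_dom c'"
      using W[of i] by (auto simp: K_def)
    moreover have "D i \<subseteq> W i"
      using disjointed_subset[of W i] by (auto simp: D_def)
    ultimately show "emeasure M ((+) x ` D i) = emeasure M (D i)"
      by (intro emeasure_volume_translate_chart[of c c'] D_sets) auto
  qed
  also have "\<dots> = emeasure M B"
    using suminf_emeasure[of D M] D_sets D_disj D_UN by (auto simp: sets_volume)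
  finally show ?thesis .
qed

text \<open>\<open>K\<close> is a closed coordinate ball, on which the continuous density is
  bounded.\<close>

lemma compact_neighbourhood:
  obtains K U where "compact K" "open U" "p \<in> U" "U \<subseteq> K" "emeasure M K < \<infinity>"
proof -
  obtain c where c: "c \<in> A" "p \<in> chart_dom c"
    using chart_around .
  note chart = is_chart[OF c(1)]
  obtain e where e: "0 < e" "cball (chart_map c p) e \<subseteq> chart_im c"
    using open_contains_cball[of "chart_im c"] open_chart_im[OF chart] chart_map_in_im[OF chart c(2)]
    by blast
  let ?B = "cball (chart_map c p) e"
  define K where "K = chart_inv c ` ?B"
  define U where "U = {q \<in> chart_dom c. chart_map c q \<in> ball (chart_map c p) e}"
  have "compact K"
    unfolding K_def using e continuous_on_subset[OF continuous_on_chart_inv[OF chart]]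
    by (intro compact_continuous_image) auto
  moreover have "open U"
    unfolding U_def by (intro open_chart_vimage[OF chart]) auto
  moreover have "p \<in> U"
    using c e by (simp add: U_def)
  moreover have "U \<subseteq> K"
  proof
    fix q assume "q \<in> U"
    then show "q \<in> K"
      unfolding K_def U_def using chart
      by (intro image_eqI[of _ _ "chart_map c q"]) (auto simp: mem_ball)
  qed
  moreover have "emeasure M K < \<infinity>"
  proof -
    have K: "K \<subseteq> chart_dom c" "K \<in> sets borel"
      using e(2) chart_inv_in_dom[OF chart] \<open>compact K\<close>
      by (auto simp: K_def intro!: borel_compact)
    have im: "chart_map c ` K = ?B"
    proof -
      have "chart_map c ` K = (\<lambda>u. u) ` ?B"
        unfolding K_def image_image using e(2) chart_map_inv[OF chart] by (intro image_cong) blast+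
      then show ?thesis
        by simp
    qed
    have "compact (vol_density c ` ?B)"
      using continuous_on_subset[OF continuous_on_vol_density[OF c(1)] e(2)]
      by (intro compact_continuous_image) auto
    then obtain b where b: "\<And>u. u \<in> ?B \<Longrightarrow> vol_density c u \<le> b"
      using compact_imp_bounded bounded_imp_bdd_above by (fastforce simp: bdd_above_def)
    have "emeasure M K = (\<integral>\<^sup>+u\<in>?B. ennreal (vol_density c u) \<partial>lborel)"
      using emeasure_volume[OF c(1) K(2,1)] im by simp
    also have "\<dots> \<le> (\<integral>\<^sup>+u\<in>?B. ennreal b \<partial>lborel)"
      using b by (intro nn_integral_mono) (auto simp: indicator_def intro: ennreal_leI)
    also have "\<dots> = ennreal b * emeasure lborel ?B"
      by (simp add: nn_integral_cmult_indicator)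
    also have "\<dots> < \<infinity>"
      using emeasure_bounded_finite[of ?B] by (simp add: ennreal_mult_less_top)
    finally show ?thesis .
  qed
  ultimately show ?thesis
    using that by blast
qed

text \<open>In a chart the density is positive, and a nonempty open set is not Lebesgue
  null.\<close>

lemma emeasure_open_pos:
  assumes "open U" "U \<noteq> {}"
  shows "0 < emeasure M U"
proof -
  obtain p where "p \<in> U"
    using assms by blast
  obtain c where c: "c \<in> A" "p \<in> chart_dom c"
    using chart_around .
  note chart = is_chart[OF c(1)]
  define V where "V = U \<inter> chart_dom c"
  have V: "open V" "V \<subseteq> chart_dom c" "p \<in> V"
    using assms open_chart_dom[OF chart] c \<open>p \<in> U\<close> by (auto simp: V_def)
  define S where "S = chart_map c ` V"
  have S: "open S" "S \<subseteq> chart_im c" "S \<noteq> {}"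
    unfolding S_def chart_image_eq[OF chart V(2)]
    using open_chart_inv_vimage[OF chart V(1)] V(3) chart_map_in_im[OF chart c(2)]
      chart_inv_map[OF chart c(2)] by auto
  have pos: "0 < vol_density c u" if "u \<in> S" for u
    using that S chart det_metric_pos[OF c(1), of "chart_inv c u"] by (auto simp: vol_density_def)
  have "(\<integral>\<^sup>+u\<in>S. ennreal (vol_density c u) \<partial>lborel) \<noteq> 0"
  proof
    assume *: "(\<integral>\<^sup>+u\<in>S. ennreal (vol_density c u) \<partial>lborel) = 0"
    have "(\<lambda>u. ennreal (vol_density c u * indicator S u)) \<in> borel_measurable lborel"
      using measurable_vol_density[OF c(1) _ S(2)] S by measurable
    moreover have "(\<lambda>u. ennreal (vol_density c u * indicator S u))
        = (\<lambda>u. ennreal (vol_density c u) * indicator S u)"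
      by (auto simp: indicator_def)
    ultimately have "AE u in lborel. ennreal (vol_density c u) * indicator S u = 0"
      using * by (subst nn_integral_0_iff_AE[symmetric]) auto
    then have "AE u in lborel. u \<notin> S"
      by eventually_elim (use pos in \<open>auto simp: indicator_def ennreal_eq_0_iff not_le[symmetric] split: if_splits\<close>)
    then have "S \<in> null_sets lborel"
      using S by (subst AE_iff_null_sets) auto
    then show False
      using open_not_negligible[OF S(1,3)]
      by (metis negligible_iff_null_sets null_sets_completionI)
  qed
  then have "0 < emeasure M V"
    using emeasure_volume[OF c(1) _ V(2)] V by (simp add: S_def zero_less_iff_neq_zero)
  also have "\<dots> \<le> emeasure M U"
    using assms by (intro emeasure_mono) (auto simp: V_def sets_volume)
  finally show ?thesis .
qed

lemma emeasure_compact_finite: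
  assumes "compact K"
  shows "emeasure M K < \<infinity>"
proof -
  let ?C = "{U. open U \<and> emeasure M U < \<infinity>}"
  have "K \<subseteq> \<Union>?C"
  proof
    fix p assume "p \<in> K"
    obtain K' U where U: "compact K'" "open U" "p \<in> U" "U \<subseteq> K'" "emeasure M K' < \<infinity>"
      using compact_neighbourhood .
    then have "emeasure M U \<le> emeasure M K'"
      by (intro emeasure_mono) (auto simp: sets_volume borel_compact)
    then show "p \<in> \<Union>?C"
      using U by auto
  qed
  then obtain C where C: "C \<subseteq> ?C" "finite C" "K \<subseteq> \<Union>C"
    using compactE[OF assms, of ?C] by (metis (no_types, lifting) mem_Collect_eq)
  have "emeasure M K \<le> emeasure M (\<Union>C)"
    using C by (intro emeasure_mono) (auto simp: sets_volume intro!: borel_open)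
  also have "\<dots> = emeasure M (\<Union>U\<in>C. U)"
    by simp
  also have "\<dots> \<le> (\<Sum>U\<in>C. emeasure M U)"
    using C by (intro emeasure_subadditive_finite) (auto simp: sets_volume)
  also have "\<dots> < \<infinity>"
    using C by (auto simp: less_top[symmetric])
  finally show ?thesis .
qed

lemma sigma_finite_volume: "sigma_finite_measure M"
proof
  define K where "K = {U. open U \<and> emeasure M U \<noteq> \<infinity>}"
  have "p \<in> \<Union>K" for p
  proof -
    obtain K' U where U: "compact K'" "open U" "p \<in> U" "U \<subseteq> K'" "emeasure M K' < \<infinity>"
      using compact_neighbourhood .
    then have "emeasure M U \<le> emeasure M K'"
      by (intro emeasure_mono) (auto simp: sets_volume borel_compact)
    then show ?thesis
      using U by (auto simp: K_def top_unique)
  qed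
  moreover obtain K' where K': "K' \<subseteq> K" "countable K'" "\<Union>K' = \<Union>K"
    by (rule Lindelof[of K]) (auto simp: K_def)
  ultimately show "\<exists>C. countable C \<and> C \<subseteq> sets M \<and> \<Union>C = space M \<and> (\<forall>a\<in>C. emeasure M a \<noteq> \<infinity>)"
    using sets_eq_imp_space_eq[OF sets_volume]
    by (intro exI[of _ K']) (auto simp: K_def sets_volume)
qed

text \<open>Right translations are homeomorphisms, so the translates of a compact neighbourhood of
  the identity stay compact and still contain nonempty open sets.\<close>

lemma haar_measure_volume: "\<exists>E. haar_measure M E"
proof -
  obtain K U where K: "compact K" "open U" "(0 :: 'g) \<in> U" "U \<subseteq> K"
    using compact_neighbourhood .
  have "haar_measure M K"
  proof (intro haar_measure.intro left_invariant_measure.intro sigma_finite_volume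
      left_invariant_measure_axioms.intro haar_measure_axioms.intro sets_volume
      emeasure_volume_translate)
    show "K \<in> sets borel"
      using K by (intro borel_compact)
    show "emeasure M ((\<lambda>b. b + x) ` K) < \<infinity>" for x
      using K by (intro emeasure_compact_finite compact_continuous_image continuous_intros)
    show "0 < emeasure M ((\<lambda>b. b + x) ` K)" for x
    proof -
      have "open ((\<lambda>b. b + - x) -` U)"
        using K by (intro open_vimage continuous_intros)
      moreover have "(\<lambda>b. b + - x) -` U = (\<lambda>b. b + x) ` U"
        by (force simp: image_iff)
      ultimately have "0 < emeasure M ((\<lambda>b. b + x) ` U)"
        using K by (intro emeasure_open_pos) auto
      also have "\<dots> \<le> emeasure M ((\<lambda>b. b + x) ` K)"
        using K by (intro emeasure_mono)
          (auto simp: sets_volume intro!: borel_compact compact_continuous_image continuous_intros)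
      finally show ?thesis .
    qed
  qed
  then show ?thesis ..
qed

end

section \<open>Invariance and measurability of the Riemannian distance\<close>

text \<open>\<open>f\<close> is arbitrary here; it will be the speed of a curve. The integral is a
  supremum over simple functions, and subtracting \<open>k\<close> from one below
  \<open>f + k\<close> leaves a measurable function below \<open>f\<close>. This uses that
  \<open>k\<close> is finite, since \<open>top - top = top\<close>.\<close>

lemma nn_integral_add_measurable_le:
  assumes [measurable]: "k \<in> borel_measurable M" and fin: "\<And>x. k x < top"
  shows "(\<integral>\<^sup>+x. f x + k x \<partial>M) \<le> (\<integral>\<^sup>+x. f x \<partial>M) + (\<integral>\<^sup>+x. k x \<partial>M)"
proof -
  have "integral\<^sup>S M h \<le> (\<integral>\<^sup>+x. f x \<partial>M) + (\<integral>\<^sup>+x. k x \<partial>M)"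
    if h: "simple_function M h" "\<And>x. h x \<le> f x + k x" for h
  proof -
    have [measurable]: "h \<in> borel_measurable M"
      using h(1) by (rule borel_measurable_simple_function)
    have "integral\<^sup>S M h = (\<integral>\<^sup>+x. h x \<partial>M)"
      using h(1) by (rule nn_integral_eq_simple_integral[symmetric])
    also have "\<dots> \<le> (\<integral>\<^sup>+x. (h x - k x) + k x \<partial>M)"
      by (intro nn_integral_mono) (metis add.commute ennreal_minus_le_iff order_refl)
    also have "\<dots> = (\<integral>\<^sup>+x. h x - k x \<partial>M) + (\<integral>\<^sup>+x. k x \<partial>M)"
      by (rule nn_integral_add) measurable
    also have "(\<integral>\<^sup>+x. h x - k x \<partial>M) \<le> (\<integral>\<^sup>+x. f x \<partial>M)"
      using h(2) fin by (intro nn_integral_mono) (auto simp: ennreal_minus_le_iff add.commute less_top[symmetric])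
    finally show ?thesis
      by (simp add: add_right_mono)
  qed
  then show ?thesis
    unfolding nn_integral_def[of M "\<lambda>x. f x + k x"] by (auto intro!: SUP_least simp: le_fun_def)
qed

lemma quadratic_form_bound:
  fixes H :: "real ^ 'n ^ 'n"
  assumes "\<And>i j. \<bar>H $ i $ j\<bar> \<le> b"
  shows "v \<bullet> (H *v v) \<le> b * (real CARD('n) * norm v)\<^sup>2"
proof -
  have "v \<bullet> (H *v v) = (\<Sum>i\<in>UNIV. \<Sum>j\<in>UNIV. v $ i * (H $ i $ j * v $ j))"
    by (simp add: inner_vec_def matrix_vector_mult_def sum_distrib_left)
  also have "\<dots> \<le> (\<Sum>i\<in>(UNIV :: 'n set). \<Sum>j\<in>(UNIV :: 'n set). norm v * (b * norm v))"
  proof (intro sum_mono)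
    fix i j
    have "v $ i * (H $ i $ j * v $ j) \<le> \<bar>v $ i\<bar> * (\<bar>H $ i $ j\<bar> * \<bar>v $ j\<bar>)"
      by (metis abs_ge_self abs_mult)
    also have "\<dots> \<le> norm v * (b * norm v)"
      using assms[of i j] component_le_norm_cart[of v]
      by (intro mult_mono) (auto intro: order_trans[of 0 "\<bar>H $ i $ j\<bar>" b])
    finally show "v $ i * (H $ i $ j * v $ j) \<le> norm v * (b * norm v)" .
  qed
  also have "\<dots> = b * (real CARD('n) * norm v)\<^sup>2"
    by (simp add: power2_eq_square)
  finally show ?thesis .
qed

section \<open>Curves, partitions and local dependence of the speed\<close>

lemma C1_curve_on_cong:
  assumes "\<And>t. t \<in> {a..b} \<Longrightarrow> \<gamma> t = \<gamma>' t" "C1_curve_on A \<gamma> a b"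
  shows "C1_curve_on A \<gamma>' a b"
  unfolding C1_curve_on_def
proof (intro conjI ballI)
  show "continuous_on {a..b} \<gamma>'"
    by (rule continuous_on_eq[of _ \<gamma>]) (use assms in \<open>auto simp: C1_curve_on_def\<close>)
  fix c assume "c \<in> A"
  then obtain D where D: "continuous_on {t \<in> {a..b}. \<gamma> t \<in> chart_dom c} D"
    "\<And>t. t \<in> {a..b} \<Longrightarrow> \<gamma> t \<in> chart_dom c \<Longrightarrow>
      ((chart_map c \<circ> \<gamma>) has_vector_derivative D t) (at t within {a..b})"
    using assms(2) unfolding C1_curve_on_def by blast
  have "{t \<in> {a..b}. \<gamma>' t \<in> chart_dom c} = {t \<in> {a..b}. \<gamma> t \<in> chart_dom c}"
    using assms(1) by auto
  moreover have "((chart_map c \<circ> \<gamma>') has_vector_derivative D t) (at t within {a..b})"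
    if "t \<in> {a..b}" "\<gamma>' t \<in> chart_dom c" for t
    by (rule has_vector_derivative_transform[OF that(1) _ D(2)]) (use assms(1) that in auto)
  ultimately show "\<exists>D. continuous_on {t \<in> {a..b}. \<gamma>' t \<in> chart_dom c} D \<and>
      (\<forall>t\<in>{a..b}. \<gamma>' t \<in> chart_dom c \<longrightarrow>
        ((chart_map c \<circ> \<gamma>') has_vector_derivative D t) (at t within {a..b}))"
    using D(1) by metis
qed

lemma C1_curve_on_subset:
  assumes "C1_curve_on A \<gamma> a b" and sub: "{a'..b'} \<subseteq> {a..b}"
  shows "C1_curve_on A \<gamma> a' b'"
  unfolding C1_curve_on_def
proof (intro conjI ballI)
  show "continuous_on {a'..b'} \<gamma>"
    using assms(1) by (auto simp: C1_curve_on_def intro: continuous_on_subset[OF _ sub])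
  fix c assume "c \<in> A"
  then obtain D where D: "continuous_on {t \<in> {a..b}. \<gamma> t \<in> chart_dom c} D"
    "\<And>t. t \<in> {a..b} \<Longrightarrow> \<gamma> t \<in> chart_dom c \<Longrightarrow>
      ((chart_map c \<circ> \<gamma>) has_vector_derivative D t) (at t within {a..b})"
    using assms(1) unfolding C1_curve_on_def by blast
  have "continuous_on {t \<in> {a'..b'}. \<gamma> t \<in> chart_dom c} D"
    by (rule continuous_on_subset[OF D(1)]) (use sub in auto)
  moreover have "((chart_map c \<circ> \<gamma>) has_vector_derivative D t) (at t within {a'..b'})"
    if "t \<in> {a'..b'}" "\<gamma> t \<in> chart_dom c" for t
    by (rule has_vector_derivative_within_subset[OF D(2) sub]) (use sub that in auto)
  ultimately show "\<exists>D. continuous_on {t \<in> {a'..b'}. \<gamma> t \<in> chart_dom c} D \<and>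
      (\<forall>t\<in>{a'..b'}. \<gamma> t \<in> chart_dom c \<longrightarrow>
        ((chart_map c \<circ> \<gamma>) has_vector_derivative D t) (at t within {a'..b'}))"
    by blast
qed

lemma partition_mono:
  fixes \<tau> :: "nat \<Rightarrow> real"
  assumes "\<And>i. i < m \<Longrightarrow> \<tau> i < \<tau> (Suc i)" "i \<le> j" "j \<le> m"
  shows "\<tau> i \<le> \<tau> j"
  using assms(2,3)
proof (induction j rule: dec_induct)
  case (step j)
  then show ?case
    using assms(1)[of j] by simp
qed simp

lemma partition_cover:
  fixes \<tau> :: "nat \<Rightarrow> real"
  assumes "\<tau> 0 \<le> t" "t \<le> \<tau> m" "t \<notin> \<tau> ` {..m}"
  obtains i where "i < m" "\<tau> i < t" "t < \<tau> (Suc i)"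
  using assms
proof (induction m arbitrary: thesis)
  case 0
  then show ?case
    by simp
next
  case (Suc m)
  show ?case
  proof (cases "t \<le> \<tau> m")
    case True
    have "t \<notin> \<tau> ` {..m}"
      using Suc.prems(4) by auto
    with True Suc.prems(2) obtain i where "i < m" "\<tau> i < t" "t < \<tau> (Suc i)"
      using Suc.IH by blast
    then show ?thesis
      using Suc.prems(1)[of i] by simp
  next
    case False
    then show ?thesis
      using Suc.prems(1)[of m] Suc.prems(3,4) by (force simp: order_less_le)
  qed
qed

lemma curve_speed_cong:
  fixes A :: "('g::topological_space, 'n::finite) chart set"
  assumes "eventually (\<lambda>s. \<gamma> s = \<gamma>' s) (nhds t)"
  shows "curve_speed A g \<gamma> t = curve_speed A g \<gamma>' t"
proof -
  have "\<gamma> t = \<gamma>' t"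
    using assms eventually_nhds_x_imp_x by blast
  moreover have "vector_derivative (chart_map c \<circ> \<gamma>) (at t) = vector_derivative (chart_map c \<circ> \<gamma>') (at t)"
    for c :: "('g, 'n) chart"
    by (rule vector_derivative_cong_eq) (use assms in \<open>auto elim!: eventually_mono\<close>)
  ultimately show ?thesis
    by (simp add: curve_speed_def Let_def)
qed

section \<open>Left translation of curves\<close>

context riemannian_lie_group
begin

text \<open>This is the chain rule in charts. Continuity of \<gamma> is a hypothesis of its own: a
  derivative of \<open>chart_map c \<circ> \<gamma>\<close> does not keep \<gamma> inside
  \<open>chart_dom c\<close>, outside which the chart map is arbitrary.\<close>

lemma transl_curve_derivative:
  assumes c: "c \<in> A" "c' \<in> A" and t: "\<gamma> t \<in> chart_dom c" "x + \<gamma> t \<in> chart_dom c'"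
    and "t \<in> S" and \<gamma>: "(\<gamma> \<longlongrightarrow> \<gamma> t) (at t within S)"
    and v: "((chart_map c \<circ> \<gamma>) has_vector_derivative v) (at t within S)"
  shows "((chart_map c' \<circ> (\<lambda>s. x + \<gamma> s)) has_vector_derivative transl_deriv x c c' (chart_map c (\<gamma> t)) v)
    (at t within S)"
proof -
  note chart = is_chart[OF c(1)]
  have "chart_map c (\<gamma> t) \<in> transl_dom x c c'"
    using c t by (intro chart_map_in_transl_dom)
  then have der: "((transl x c c' \<circ> (chart_map c \<circ> \<gamma>)) has_vector_derivative
      transl_deriv x c c' (chart_map c (\<gamma> t)) v) (at t within S)"
    using transl_has_derivative[OF c]
    by (intro vector_derivative_diff_chain_within[OF v]) (auto intro: has_derivative_at_withinI)
  have "eventually (\<lambda>s. \<gamma> s \<in> chart_dom c) (at t within S)"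
    using topological_tendstoD[OF \<gamma> open_chart_dom[OF chart] t(1)] .
  then have ev: "eventually (\<lambda>s. (transl x c c' \<circ> (chart_map c \<circ> \<gamma>)) s
      = (chart_map c' \<circ> (\<lambda>s. x + \<gamma> s)) s) (at t within S)"
    by (rule eventually_mono) (use chart in \<open>auto simp: transl_def\<close>)
  have eq: "(transl x c c' \<circ> (chart_map c \<circ> \<gamma>)) t = (chart_map c' \<circ> (\<lambda>s. x + \<gamma> s)) t"
    using t chart by (simp add: transl_def)
  show ?thesis
    unfolding has_vector_derivative_def
    by (rule has_derivative_transform_eventually[OF der[unfolded has_vector_derivative_def] ev eq \<open>t \<in> S\<close>])
qed

text \<open>The speed is computed in a chart picked by \<open>SOME\<close>. Isometry holds for every
  pair of charts, so it handles the translation and this choice at once; \<open>x = 0\<close> gives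
  independence of the chart.\<close>

lemma curve_speed_translate:
  assumes c: "c \<in> A" and t: "\<gamma> t \<in> chart_dom c" and \<gamma>: "(\<gamma> \<longlongrightarrow> \<gamma> t) (at t)"
    and v: "((chart_map c \<circ> \<gamma>) has_vector_derivative v) (at t)"
  shows "curve_speed A g (\<lambda>s. x + \<gamma> s) t = sqrt (v \<bullet> (g c (\<gamma> t) *v v))"
proof -
  define c' where "c' = (SOME c'. c' \<in> A \<and> x + \<gamma> t \<in> chart_dom c')"
  have "\<exists>c'. c' \<in> A \<and> x + \<gamma> t \<in> chart_dom c'"
    using chart_around by metis
  then have "c' \<in> A \<and> x + \<gamma> t \<in> chart_dom c'"
    unfolding c'_def by (rule someI_ex)
  then have c': "c' \<in> A" "x + \<gamma> t \<in> chart_dom c'"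
    by auto
  have "vector_derivative (chart_map c' \<circ> (\<lambda>s. x + \<gamma> s)) (at t) = transl_deriv x c c' (chart_map c (\<gamma> t)) v"
    by (rule vector_derivative_at) (intro transl_curve_derivative c c' t \<gamma> v UNIV_I)
  then show ?thesis
    using transl_deriv_isometric[OF c c'(1) t c'(2)]
    by (simp add: curve_speed_def Let_def c'_def[symmetric])
qed

lemma curve_speed_eq:
  assumes "c \<in> A" "\<gamma> t \<in> chart_dom c" "(\<gamma> \<longlongrightarrow> \<gamma> t) (at t)"
    and "((chart_map c \<circ> \<gamma>) has_vector_derivative v) (at t)"
  shows "curve_speed A g \<gamma> t = sqrt (v \<bullet> (g c (\<gamma> t) *v v))"
  using curve_speed_translate[OF assms, of 0] by simp

text \<open>Continuity of the derivative is known for fixed directions; expanding \<open>D t\<close>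
  in the standard basis extends it to moving ones.\<close>

lemma continuous_on_transl_deriv_curve:
  assumes c: "c \<in> A" "c' \<in> A" and u: "continuous_on S u" "\<And>t. t \<in> S \<Longrightarrow> u t \<in> transl_dom x c c'"
    and D: "continuous_on S D"
  shows "continuous_on S (\<lambda>t. transl_deriv x c c' (u t) (D t))"
proof -
  have eq: "transl_deriv x c c' (u t) (D t) = (\<Sum>i\<in>UNIV. D t $ i *\<^sub>R transl_deriv x c c' (u t) (axis i 1))"
    if "t \<in> S" for t
  proof -
    have "linear (transl_deriv x c c' (u t))"
      using transl_has_derivative[OF c u(2)[OF that]] has_derivative_linear by blast
    then have "transl_deriv x c c' (u t) (\<Sum>i\<in>UNIV. D t $ i *\<^sub>R axis i 1)
        = (\<Sum>i\<in>UNIV. D t $ i *\<^sub>R transl_deriv x c c' (u t) (axis i 1))"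
      by (simp add: linear_sum linear_scale)
    then show ?thesis
      using basis_expansion[of "D t"] by (simp add: scalar_mult_eq_scaleR)
  qed
  have "continuous_on S (\<lambda>t. \<Sum>i\<in>UNIV. D t $ i *\<^sub>R transl_deriv x c c' (u t) (axis i 1))"
    by (intro continuous_intros D continuous_on_compose2[OF continuous_on_transl_deriv[OF c] u(1)])
      (use u(2) in auto)
  then show ?thesis
    by (simp add: eq cong: continuous_on_cong)
qed

text \<open>One continuous derivative is demanded on all times spent in \<open>c'\<close>, but the
  chain rule works through a second chart that is available only locally. Hence \<open>D\<close> is
  defined globally by \<open>vector_derivative\<close>, and its continuity is checked near each
  time. The assumption \<open>a < b\<close> makes derivatives within the interval unique.\<close>

lemma C1_curve_on_translate:
  assumes \<gamma>: "C1_curve_on A \<gamma> a b" and ab: "a < b"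
  shows "C1_curve_on A (\<lambda>t. x + \<gamma> t) a b"
  unfolding C1_curve_on_def
proof (intro conjI ballI)
  have cont: "continuous_on {a..b} \<gamma>"
    using \<gamma> by (simp add: C1_curve_on_def)
  then show "continuous_on {a..b} (\<lambda>t. x + \<gamma> t)"
    by (intro continuous_intros)
  fix c' assume c': "c' \<in> A"
  let ?T = "{t \<in> {a..b}. x + \<gamma> t \<in> chart_dom c'}"
  define D where "D t = vector_derivative (chart_map c' \<circ> (\<lambda>t. x + \<gamma> t)) (at t within {a..b})" for t
  have local: "((chart_map c' \<circ> (\<lambda>t. x + \<gamma> t)) has_vector_derivative D t0) (at t0 within {a..b})
      \<and> (D \<longlongrightarrow> D t0) (at t0 within ?T)" if t0: "t0 \<in> ?T" for t0
  proof -
    obtain c where c: "c \<in> A" "\<gamma> t0 \<in> chart_dom c"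
      using chart_around .
    obtain E where E: "continuous_on {t \<in> {a..b}. \<gamma> t \<in> chart_dom c} E"
      "\<And>t. t \<in> {a..b} \<Longrightarrow> \<gamma> t \<in> chart_dom c \<Longrightarrow>
        ((chart_map c \<circ> \<gamma>) has_vector_derivative E t) (at t within {a..b})"
      using \<gamma> c(1) unfolding C1_curve_on_def by blast
    let ?N = "{t \<in> {a..b}. \<gamma> t \<in> chart_dom c \<and> x + \<gamma> t \<in> chart_dom c'}"
    have der: "((chart_map c' \<circ> (\<lambda>t. x + \<gamma> t)) has_vector_derivative
        transl_deriv x c c' (chart_map c (\<gamma> t)) (E t)) (at t within {a..b})" if "t \<in> ?N" for t
      using that cont by (intro transl_curve_derivative c c' E(2)) (auto simp: continuous_on_def)
    then have D_eq: "D t = transl_deriv x c c' (chart_map c (\<gamma> t)) (E t)" if "t \<in> ?N" for t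
      unfolding D_def using that ab by (intro vector_derivative_within_closed_interval) auto
    have "continuous_on ?N (\<lambda>t. transl_deriv x c c' (chart_map c (\<gamma> t)) (E t))"
    proof (intro continuous_on_transl_deriv_curve c(1) c')
      show "continuous_on ?N (\<lambda>t. chart_map c (\<gamma> t))"
        by (rule continuous_on_compose2[OF continuous_on_chart_map[OF is_chart[OF c(1)]]
              continuous_on_subset[OF cont]]) auto
      show "continuous_on ?N E"
        by (rule continuous_on_subset[OF E(1)]) auto
      show "chart_map c (\<gamma> t) \<in> transl_dom x c c'" if "t \<in> ?N" for t
        using that c by (intro chart_map_in_transl_dom) auto
    qed
    then have "continuous_on ?N D"
      by (rule continuous_on_eq) (rule D_eq[symmetric])
    then have "(D \<longlongrightarrow> D t0) (at t0 within ?N)"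
      using t0 c by (simp add: continuous_on_def)
    moreover obtain U where U: "open U" "U \<inter> {a..b} = \<gamma> -` chart_dom c \<inter> {a..b}"
      using cont open_chart_dom[OF is_chart[OF c(1)]] unfolding continuous_on_open_invariant by metis
    have "at t0 within ?T = at t0 within ?N"
      by (rule at_within_nhd[of _ U]) (use U t0 c in blast)+
    ultimately show ?thesis
      using der[of t0] D_eq[of t0] t0 c by simp
  qed
  then show "\<exists>D. continuous_on ?T D \<and> (\<forall>t\<in>{a..b}. x + \<gamma> t \<in> chart_dom c' \<longrightarrow>
      ((chart_map c' \<circ> (\<lambda>t. x + \<gamma> t)) has_vector_derivative D t) (at t within {a..b}))"
    by (intro exI[of _ D]) (simp add: continuous_on_def)
qed

text \<open>Other charts are reached by the change of charts, which is translation by 0.\<close>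

lemma C1_curve_on_in_chart:
  assumes c: "c \<in> A" and cont: "continuous_on {a..b} \<gamma>" and dom: "\<And>t. t \<in> {a..b} \<Longrightarrow> \<gamma> t \<in> chart_dom c"
    and D: "continuous_on {a..b} D"
    and der: "\<And>t. t \<in> {a..b} \<Longrightarrow> ((chart_map c \<circ> \<gamma>) has_vector_derivative D t) (at t within {a..b})"
  shows "C1_curve_on A \<gamma> a b"
  unfolding C1_curve_on_def
proof (intro conjI ballI cont)
  fix c' assume c': "c' \<in> A"
  let ?N = "{t \<in> {a..b}. \<gamma> t \<in> chart_dom c'}"
  have "((chart_map c' \<circ> \<gamma>) has_vector_derivative transl_deriv 0 c c' (chart_map c (\<gamma> t)) (D t))
      (at t within {a..b})" if "t \<in> ?N" for t
    using that cont transl_curve_derivative[OF c c', of \<gamma> t 0] der dom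
    by (auto simp: continuous_on_def)
  moreover have "continuous_on ?N (\<lambda>t. transl_deriv 0 c c' (chart_map c (\<gamma> t)) (D t))"
  proof (intro continuous_on_transl_deriv_curve c c')
    show "continuous_on ?N (\<lambda>t. chart_map c (\<gamma> t))"
      by (rule continuous_on_compose2[OF continuous_on_chart_map[OF is_chart[OF c]]
            continuous_on_subset[OF cont]]) (use dom in auto)
    show "continuous_on ?N D"
      by (rule continuous_on_subset[OF D]) auto
    show "chart_map c (\<gamma> t) \<in> transl_dom 0 c c'" if "t \<in> ?N" for t
      using that c dom by (intro chart_map_in_transl_dom) auto
  qed
  ultimately show "\<exists>D. continuous_on ?N D \<and> (\<forall>t\<in>{a..b}. \<gamma> t \<in> chart_dom c' \<longrightarrow>
      ((chart_map c' \<circ> \<gamma>) has_vector_derivative D t) (at t within {a..b}))"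
    by (intro exI[of _ "\<lambda>t. transl_deriv 0 c c' (chart_map c (\<gamma> t)) (D t)"]) simp
qed

lemma curve_speed_translate_eq:
  assumes \<gamma>: "C1_curve_on A \<gamma> a b" and t: "a < t" "t < b"
  shows "curve_speed A g (\<lambda>s. x + \<gamma> s) t = curve_speed A g \<gamma> t"
proof -
  obtain c where c: "c \<in> A" "\<gamma> t \<in> chart_dom c"
    using chart_around .
  obtain D where D: "\<And>t. t \<in> {a..b} \<Longrightarrow> \<gamma> t \<in> chart_dom c \<Longrightarrow>
      ((chart_map c \<circ> \<gamma>) has_vector_derivative D t) (at t within {a..b})"
    using \<gamma> c(1) unfolding C1_curve_on_def by blast
  have at: "at t within {a..b} = at t"
    using t by (rule at_within_Icc_at)
  have "((chart_map c \<circ> \<gamma>) has_vector_derivative D t) (at t)"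
    using D[of t] c t at by simp
  moreover have "continuous_on {a..b} \<gamma>"
    using \<gamma> by (simp add: C1_curve_on_def)
  then have "(\<gamma> \<longlongrightarrow> \<gamma> t) (at t within {a..b})"
    using t by (auto simp: continuous_on_def)
  then have "(\<gamma> \<longlongrightarrow> \<gamma> t) (at t)"
    unfolding at .
  ultimately show ?thesis
    using c curve_speed_translate[of c \<gamma> t "D t" x] curve_speed_eq[of c \<gamma> t "D t"] by simp
qed

lemma
  assumes \<gamma>: "piecewise_C1_curve A \<gamma>"
  shows piecewise_C1_curve_translate: "piecewise_C1_curve A (\<lambda>t. x + \<gamma> t)"
    and curve_length_translate: "curve_length A g (\<lambda>t. x + \<gamma> t) = curve_length A g \<gamma>"
proof -
  obtain m \<tau> where \<tau>: "\<tau> 0 = 0" "\<tau> m = (1 :: real)"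
    "\<And>i. i < m \<Longrightarrow> \<tau> i < \<tau> (Suc i)" "\<And>i. i < m \<Longrightarrow> C1_curve_on A \<gamma> (\<tau> i) (\<tau> (Suc i))"
    using \<gamma> unfolding piecewise_C1_curve_def by blast
  then show "piecewise_C1_curve A (\<lambda>t. x + \<gamma> t)"
    unfolding piecewise_C1_curve_def by (intro exI[of _ m] exI[of _ \<tau>]) (auto intro: C1_curve_on_translate)
  have "AE t in lborel. t \<notin> \<tau> ` {..m}"
    by (intro AE_not_in finite_imp_null_set_lborel) auto
  then show "curve_length A g (\<lambda>t. x + \<gamma> t) = curve_length A g \<gamma>"
    unfolding curve_length_def
  proof (intro nn_integral_cong_AE, eventually_elim)
    case (elim t)
    have "curve_speed A g (\<lambda>t. x + \<gamma> t) t = curve_speed A g \<gamma> t" if t01: "t \<in> {0..1}"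
    proof -
      obtain i where "i < m" "\<tau> i < t" "t < \<tau> (Suc i)"
        using t01 \<tau>(1,2) elim by (elim partition_cover[of \<tau> t m, rotated -1]) auto
      then show ?thesis
        using \<tau> curve_speed_translate_eq by blast
    qed
    then show ?case
      by (auto simp: indicator_def)
  qed
qed

lemma riemannian_dist_translate: "riemannian_dist A g (x + a) (x + b) = riemannian_dist A g a b"
proof -
  have le: "riemannian_dist A g (x + a) (x + b) \<le> riemannian_dist A g a b" for x a b
    unfolding riemannian_dist_def
  proof (rule INF_greatest)
    fix \<gamma> assume "\<gamma> \<in> {\<gamma>. piecewise_C1_curve A \<gamma> \<and> \<gamma> 0 = a \<and> \<gamma> 1 = b}"
    then show "(INF \<gamma> \<in> {\<gamma>. piecewise_C1_curve A \<gamma> \<and> \<gamma> 0 = x + a \<and> \<gamma> 1 = x + b}. curve_length A g \<gamma>)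
        \<le> curve_length A g \<gamma>"
      by (intro INF_lower2[of "\<lambda>t. x + \<gamma> t"])
        (auto simp: piecewise_C1_curve_translate curve_length_translate)
  qed
  \<comment> \<open>Translating back gives the reverse inequality.\<close>
  have "riemannian_dist A g (- x + (x + a)) (- x + (x + b)) \<le> riemannian_dist A g (x + a) (x + b)"
    by (rule le)
  then show ?thesis
    using le[of x a b] by (simp add: add.assoc[symmetric])
qed

lemma rball_eq: "rball A g x r = {y. riemannian_dist A g 0 (- x + y) < ennreal r}"
proof -
  have "riemannian_dist A g x y = riemannian_dist A g 0 (- x + y)" for y
    using riemannian_dist_translate[of x 0 "- x + y"] by (simp add: add.assoc[symmetric])
  then show ?thesis
    by (simp add: rball_def)
qed

section \<open>Local speed bounds and openness of the balls\<close>

lemma chart_speed_bound: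
  assumes c: "c \<in> A" and p: "p \<in> chart_dom c"
  obtains e C where "0 < e" "0 < C" "cball (chart_map c p) e \<subseteq> chart_im c"
    "\<And>u v. u \<in> cball (chart_map c p) e \<Longrightarrow> sqrt (v \<bullet> (g c (chart_inv c u) *v v)) \<le> C * norm v"
proof -
  note chart = is_chart[OF c]
  obtain e where e: "0 < e" "cball (chart_map c p) e \<subseteq> chart_im c"
    using open_contains_cball[of "chart_im c"] open_chart_im[OF chart] chart_map_in_im[OF chart p]
    by blast
  have "\<exists>b. \<forall>u\<in>cball (chart_map c p) e. \<bar>g c (chart_inv c u) $ i $ j\<bar> \<le> b" for i j
  proof -
    have "compact ((\<lambda>u. g c (chart_inv c u) $ i $ j) ` cball (chart_map c p) e)"
      using continuous_on_subset[OF continuous_on_metric[OF c] e(2)]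
      by (intro compact_continuous_image) auto
    then show ?thesis
      using compact_imp_bounded by (fastforce simp: bounded_iff)
  qed
  then obtain b where b: "\<And>i j u. u \<in> cball (chart_map c p) e \<Longrightarrow> \<bar>g c (chart_inv c u) $ i $ j\<bar> \<le> b i j"
    by metis
  \<comment> \<open>The summand 1 makes the constant positive, so that \<open>open_rball\<close> can
    divide by it.\<close>
  define B where "B = (\<Sum>i\<in>UNIV. \<Sum>j\<in>UNIV. \<bar>b i j\<bar>) + 1"
  have B: "b i j \<le> B" for i j
  proof -
    have "b i j \<le> (\<Sum>j\<in>UNIV. \<bar>b i j\<bar>)"
      using member_le_sum[of j UNIV "\<lambda>j. \<bar>b i j\<bar>"] by simp
    also have "\<dots> \<le> (\<Sum>i\<in>UNIV. \<Sum>j\<in>UNIV. \<bar>b i j\<bar>)"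
      by (rule member_le_sum) (auto intro: sum_nonneg)
    finally show ?thesis
      by (simp add: B_def)
  qed
  have "0 < B"
    unfolding B_def by (intro add_nonneg_pos sum_nonneg) auto
  have "sqrt (v \<bullet> (g c (chart_inv c u) *v v)) \<le> (sqrt B * real CARD('n)) * norm v"
    if u: "u \<in> cball (chart_map c p) e" for u v
  proof -
    have "v \<bullet> (g c (chart_inv c u) *v v) \<le> B * (real CARD('n) * norm v)\<^sup>2"
      using b[OF u] B by (intro quadratic_form_bound) (meson order_trans)
    then have "sqrt (v \<bullet> (g c (chart_inv c u) *v v)) \<le> sqrt (B * (real CARD('n) * norm v)\<^sup>2)"
      by (rule real_sqrt_le_mono)
    then show ?thesis
      by (simp add: real_sqrt_mult mult.assoc)
  qed
  then show ?thesis
    using that[OF e(1) _ e(2), of "sqrt B * real CARD('n)"] \<open>0 < B\<close> by simp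
qed

text \<open>
  The end of a curve is replaced by a straight segment in a chart. This needs no
  reparametrisation, in contrast to the concatenation of two curves.
\<close>

lemma riemannian_dist_replace_end:
  assumes \<gamma>: "piecewise_C1_curve A \<gamma>" "\<gamma> 0 = a" "\<gamma> 1 = y"
    and c: "c \<in> A" "y \<in> chart_dom c"
    and C: "0 < C" "cball (chart_map c y) \<eta> \<subseteq> chart_im c"
      "\<And>u v. u \<in> cball (chart_map c y) \<eta> \<Longrightarrow> sqrt (v \<bullet> (g c (chart_inv c u) *v v)) \<le> C * norm v"
    and \<eta>: "0 < \<eta>" and z: "z \<in> chart_dom c" "chart_map c z \<in> ball (chart_map c y) \<eta>"
  shows "riemannian_dist A g a z \<le> curve_length A g \<gamma> + ennreal (C * (2 * \<eta>))"
proof -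
  note chart = is_chart[OF c(1)]
  obtain m \<tau> where \<tau>: "\<tau> 0 = 0" "\<tau> m = (1 :: real)"
    "\<And>i. i < m \<Longrightarrow> \<tau> i < \<tau> (Suc i)" "\<And>i. i < m \<Longrightarrow> C1_curve_on A \<gamma> (\<tau> i) (\<tau> (Suc i))"
    using \<gamma>(1) unfolding piecewise_C1_curve_def by blast
  obtain n where n: "m = Suc n"
    using \<tau>(1,2) by (cases m) auto
  have C1_last: "C1_curve_on A \<gamma> (\<tau> n) 1" and \<tau>n: "\<tau> n < 1"
    using \<tau>(2) \<tau>(3,4)[of n] n by auto
  have \<tau>n0: "0 \<le> \<tau> n"
    using partition_mono[of m \<tau> 0 n] \<tau> n by auto
  have "open {p \<in> chart_dom c. chart_map c p \<in> ball (chart_map c y) \<eta>}"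
    by (intro open_chart_vimage[OF chart]) auto
  moreover have "(\<gamma> \<longlongrightarrow> \<gamma> 1) (at 1 within {\<tau> n..1})"
    using C1_last \<tau>n by (auto simp: C1_curve_on_def continuous_on_def)
  ultimately have "eventually (\<lambda>s. \<gamma> s \<in> {p \<in> chart_dom c. chart_map c p \<in> ball (chart_map c y) \<eta>})
      (at 1 within {\<tau> n..1})"
    using c \<eta> \<gamma>(3) by (intro topological_tendstoD) auto
  moreover have "at 1 within {\<tau> n..1} = at_left 1"
    using \<tau>n by (rule at_within_Icc_at_left)
  moreover have "eventually (\<lambda>s. s \<in> {\<tau> n<..<1}) (at_left 1)"
    using \<tau>n by (rule eventually_at_left_real)
  ultimately have "eventually (\<lambda>s. s \<in> {\<tau> n<..<1} \<and> \<gamma> s \<in> chart_dom c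
      \<and> chart_map c (\<gamma> s) \<in> ball (chart_map c y) \<eta>) (at_left 1)"
    by (auto elim: eventually_elim2)
  then obtain s where s: "\<tau> n < s" "s < 1" "\<gamma> s \<in> chart_dom c"
      "chart_map c (\<gamma> s) \<in> ball (chart_map c y) \<eta>"
    using eventually_happens[of _ "at_left (1 :: real)"] by auto
  \<comment> \<open>With this velocity the segment leaves \<gamma> at time \<open>s\<close> and
    reaches \<open>z\<close> exactly at time 1.\<close>
  define v where "v = (chart_map c z - chart_map c (\<gamma> s)) /\<^sub>R (1 - s)"
  define l where "l t = chart_map c (\<gamma> s) + (t - s) *\<^sub>R v" for t
  have l_in: "l t \<in> cball (chart_map c y) \<eta>" if "t \<in> {s..1}" for t
  proof -
    let ?\<theta> = "(t - s) / (1 - s)"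
    have "l t = (1 - ?\<theta>) *\<^sub>R chart_map c (\<gamma> s) + ?\<theta> *\<^sub>R chart_map c z"
      by (simp add: l_def v_def algebra_simps divide_inverse)
    moreover have "0 \<le> ?\<theta>" "?\<theta> \<le> 1"
      using that s by auto
    ultimately show ?thesis
      using convexD_alt[OF convex_cball, of "chart_map c (\<gamma> s)" "chart_map c y" \<eta> "chart_map c z" ?\<theta>] s z
      by auto
  qed
  then have l_im: "l t \<in> chart_im c" if "t \<in> {s..1}" for t
    using C(2) that by blast
  have l_der: "(l has_vector_derivative v) (at t within S)" for t S
    unfolding l_def by (auto intro!: derivative_eq_intros)
  define \<sigma> where "\<sigma> t = chart_inv c (l t)" for t
  have \<sigma>_map: "chart_map c (\<sigma> t) = l t" if "t \<in> {s..1}" for t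
    unfolding \<sigma>_def using chart_map_inv[OF chart l_im[OF that]] .
  have \<sigma>_cont: "continuous_on {s..1} \<sigma>"
    unfolding \<sigma>_def
    by (rule continuous_on_compose2[OF continuous_on_chart_inv[OF chart]])
      (use l_im in \<open>auto simp: l_def intro!: continuous_intros\<close>)
  have \<sigma>_C1: "C1_curve_on A \<sigma> s 1"
  proof (rule C1_curve_on_in_chart[OF c(1) \<sigma>_cont])
    show "\<sigma> t \<in> chart_dom c" if "t \<in> {s..1}" for t
      unfolding \<sigma>_def using chart_inv_in_dom[OF chart l_im[OF that]] .
    show "((chart_map c \<circ> \<sigma>) has_vector_derivative v) (at t within {s..1})" if "t \<in> {s..1}" for t
      by (rule has_vector_derivative_transform[OF that _ l_der]) (simp add: \<sigma>_map)
  qed simp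
  define \<gamma>' where "\<gamma>' t = (if t \<le> s then \<gamma> t else \<sigma> t)" for t
  have \<sigma>_s: "\<sigma> s = \<gamma> s"
    using s chart by (simp add: \<sigma>_def l_def)
  have "l 1 = chart_map c z"
    using s by (simp add: l_def v_def)
  then have ends: "\<gamma>' 0 = a" "\<gamma>' 1 = z"
    using \<gamma> s \<tau>n0 z chart by (auto simp: \<gamma>'_def \<sigma>_def)
  \<comment> \<open>The break points of \<gamma> before 1 are kept, and \<open>s\<close> is inserted
    between the last of them and 1.\<close>
  let ?\<tau> = "\<lambda>i. if i \<le> n then \<tau> i else if i = Suc n then s else 1"
  have piece: "?\<tau> i < ?\<tau> (Suc i) \<and> C1_curve_on A \<gamma>' (?\<tau> i) (?\<tau> (Suc i))"
    if i: "i < Suc (Suc n)" for i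
  proof -
    consider "i < n" | "i = n" | "i = Suc n"
      using i by (metis less_Suc_eq)
    then show ?thesis
    proof cases
      case 1
      have "\<tau> (Suc i) \<le> \<tau> n"
        using partition_mono[of m \<tau> "Suc i" n] \<tau> n 1 by auto
      then have "C1_curve_on A \<gamma>' (\<tau> i) (\<tau> (Suc i))"
        using s 1 n by (intro C1_curve_on_cong[OF _ \<tau>(4)]) (auto simp: \<gamma>'_def)
      then show ?thesis
        using 1 \<tau>(3)[of i] n by simp
    next
      case 2
      have "C1_curve_on A \<gamma> (\<tau> n) s"
        using s by (intro C1_curve_on_subset[OF C1_last]) auto
      then have "C1_curve_on A \<gamma>' (\<tau> n) s"
        by (rule C1_curve_on_cong[rotated]) (auto simp: \<gamma>'_def)
      then show ?thesis
        using 2 s by simp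
    next
      case 3
      have "C1_curve_on A \<gamma>' s 1"
        by (rule C1_curve_on_cong[OF _ \<sigma>_C1]) (use \<sigma>_s in \<open>auto simp: \<gamma>'_def\<close>)
      then show ?thesis
        using 3 s by simp
    qed
  qed
  have "piecewise_C1_curve A \<gamma>'"
    unfolding piecewise_C1_curve_def
    by (rule exI[of _ "Suc (Suc n)"], rule exI[of _ ?\<tau>]) (use piece \<tau>(1) in simp)
  then have "riemannian_dist A g a z \<le> curve_length A g \<gamma>'"
    unfolding riemannian_dist_def using ends by (intro INF_lower) auto
  \<comment> \<open>The speed of \<gamma> is kept on the whole unit interval, even after
    \<open>s\<close>; this only enlarges the bound and makes the full length of \<gamma>
    appear.\<close>
  also have "\<dots> \<le> (\<integral>\<^sup>+t. ennreal (curve_speed A g \<gamma> t) * indicator {0..1} t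
      + ennreal (C * norm v) * indicator {s..1} t \<partial>lborel)"
    unfolding curve_length_def
  proof (rule nn_integral_mono_AE)
    have "AE t in lborel. t \<notin> {s, 1}"
      by (intro AE_not_in finite_imp_null_set_lborel) auto
    then show "AE t in lborel. ennreal (curve_speed A g \<gamma>' t) * indicator {0..1} t
        \<le> ennreal (curve_speed A g \<gamma> t) * indicator {0..1} t + ennreal (C * norm v) * indicator {s..1} t"
    proof eventually_elim
      case (elim t)
      consider "t < s" | "s < t" "t < 1" | "1 < t"
        using elim by fastforce
      then show ?case
      proof cases
        case 1
        then have "eventually (\<lambda>t. t < s) (nhds t)"
          by (intro eventually_nhds_in_open[of "{..<s}", simplified]) auto
        then have "curve_speed A g \<gamma>' t = curve_speed A g \<gamma> t"
          by (intro curve_speed_cong) (auto simp: \<gamma>'_def elim!: eventually_mono)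
        then show ?thesis
          by simp
      next
        case 2
        have at: "at t within {s..1} = at t"
          using 2 by (rule at_within_Icc_at)
        have "eventually (\<lambda>t. s < t) (nhds t)"
          using 2 by (intro eventually_nhds_in_open[of "{s<..}", simplified]) auto
        then have "curve_speed A g \<gamma>' t = curve_speed A g \<sigma> t"
          by (intro curve_speed_cong) (auto simp: \<gamma>'_def elim!: eventually_mono)
        also have "\<dots> = sqrt (v \<bullet> (g c (\<sigma> t) *v v))"
        proof (rule curve_speed_eq[OF c(1)])
          show "\<sigma> t \<in> chart_dom c"
            unfolding \<sigma>_def using chart_inv_in_dom[OF chart l_im] 2 by simp
          have "(\<sigma> \<longlongrightarrow> \<sigma> t) (at t within {s..1})"
            using \<sigma>_cont 2 by (auto simp: continuous_on_def)
          then show "(\<sigma> \<longlongrightarrow> \<sigma> t) (at t)"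
            unfolding at .
          have "((chart_map c \<circ> \<sigma>) has_vector_derivative v) (at t within {s..1})"
            by (rule has_vector_derivative_transform[OF _ _ l_der]) (use 2 in \<open>auto simp: \<sigma>_map\<close>)
          then show "((chart_map c \<circ> \<sigma>) has_vector_derivative v) (at t)"
            using at by simp
        qed
        also have "\<dots> \<le> C * norm v"
          unfolding \<sigma>_def using C(3)[OF l_in] 2 by simp
        finally have "ennreal (curve_speed A g \<gamma>' t) \<le> ennreal (C * norm v)"
          by (rule ennreal_leI)
        also have "\<dots> \<le> ennreal (curve_speed A g \<gamma> t) + ennreal (C * norm v)"
          by simp
        finally show ?thesis
          using 2 \<tau>n0 s(1) by simp
      next
        case 3
        then show ?thesis
          by simp
      qed
    qed
  qed
  also have "\<dots> \<le> curve_length A g \<gamma> + (\<integral>\<^sup>+t. ennreal (C * norm v) * indicator {s..1} t \<partial>lborel)"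
    unfolding curve_length_def
    by (rule nn_integral_add_measurable_le) (auto simp: indicator_def)
  also have "(\<integral>\<^sup>+t. ennreal (C * norm v) * indicator {s..1} t \<partial>lborel) = ennreal (C * norm v) * ennreal (1 - s)"
    using s by (subst nn_integral_cmult_indicator) auto
  \<comment> \<open>Velocity times remaining time is the coordinate displacement. Both end points
    lie in the ball of radius \<eta>, hence the factor 2.\<close>
  also have "\<dots> = ennreal (C * dist (chart_map c z) (chart_map c (\<gamma> s)))"
    using s C(1) by (simp add: v_def dist_norm flip: ennreal_mult)
  also have "\<dots> \<le> ennreal (C * (2 * \<eta>))"
  proof (intro ennreal_leI mult_left_mono)
    show "dist (chart_map c z) (chart_map c (\<gamma> s)) \<le> 2 * \<eta>"
      using z(2) s(4) dist_triangle2[of "chart_map c z" "chart_map c (\<gamma> s)" "chart_map c y"]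
      by (simp add: dist_commute)
  qed (use C in simp)
  finally show ?thesis
    by (simp add: add_left_mono)
qed

text \<open>A curve from \<open>a\<close> to \<open>y\<close> of length below \<open>r\<close>
  leaves some slack, which \<open>riemannian_dist_replace_end\<close> spends on reaching every point
  near \<open>y\<close>.\<close>

lemma open_rball: "open {y. riemannian_dist A g a y < r}"
proof (subst open_subopen, safe)
  fix y assume "riemannian_dist A g a y < r"
  then obtain \<gamma> where \<gamma>: "piecewise_C1_curve A \<gamma>" "\<gamma> 0 = a" "\<gamma> 1 = y" "curve_length A g \<gamma> < r"
    unfolding riemannian_dist_def INF_less_iff by blast
  obtain c where c: "c \<in> A" "y \<in> chart_dom c"
    using chart_around .
  obtain e C where C: "0 < e" "0 < C" "cball (chart_map c y) e \<subseteq> chart_im c"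
    "\<And>u v. u \<in> cball (chart_map c y) e \<Longrightarrow> sqrt (v \<bullet> (g c (chart_inv c u) *v v)) \<le> C * norm v"
    using chart_speed_bound[OF c] by metis
  obtain \<epsilon> where \<epsilon>: "0 < \<epsilon>" "curve_length A g \<gamma> + ennreal \<epsilon> < r"
  proof -
    obtain L where L: "curve_length A g \<gamma> = ennreal L" "0 \<le> L"
      using \<gamma>(4) by (cases "curve_length A g \<gamma>") auto
    \<comment> \<open>\<open>R\<close> is a finite bound strictly between the length and
      \<open>r\<close>, which may itself be \<infinity>.\<close>
    obtain R where R: "ennreal L < R" "R < r"
      using \<gamma>(4) dense L by metis
    then obtain R' where R': "R = ennreal R'" "0 \<le> R'"
      by (cases R) auto
    then have "L < R'"
      using R L by (simp add: ennreal_less_iff)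
    then show ?thesis
      using that[of "R' - L"] R R' L by (simp flip: ennreal_plus)
  qed
  \<comment> \<open>The new end costs at most \<open>C * (2 * \<eta>)\<close>, which must not exceed
    \<epsilon>; the speed bound holds up to radius \<open>e\<close>.\<close>
  define \<eta> where "\<eta> = min e (\<epsilon> / (2 * C))"
  have \<eta>: "0 < \<eta>" "\<eta> \<le> e" "C * (2 * \<eta>) \<le> \<epsilon>"
    using C \<epsilon> by (auto simp: \<eta>_def min_def field_simps)
  let ?U = "{z \<in> chart_dom c. chart_map c z \<in> ball (chart_map c y) \<eta>}"
  have "open ?U"
    by (intro open_chart_vimage is_chart c) auto
  moreover have "y \<in> ?U"
    using c \<eta> by simp
  moreover have "?U \<subseteq> {y. riemannian_dist A g a y < r}"
  proof safe
    fix z assume z: "z \<in> chart_dom c" "chart_map c z \<in> ball (chart_map c y) \<eta>"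
    have sub: "cball (chart_map c y) \<eta> \<subseteq> cball (chart_map c y) e"
      using \<eta> by auto
    have "riemannian_dist A g a z \<le> curve_length A g \<gamma> + ennreal (C * (2 * \<eta>))"
      by (rule riemannian_dist_replace_end[OF \<gamma>(1-3) c C(2) _ _ \<eta>(1) z]) (use sub C in blast)+
    also have "\<dots> \<le> curve_length A g \<gamma> + ennreal \<epsilon>"
      using \<eta> by (intro add_left_mono ennreal_leI)
    finally show "riemannian_dist A g a z < r"
      using \<epsilon> by simp
  qed
  ultimately show "\<exists>U. open U \<and> y \<in> U \<and> U \<subseteq> {y. riemannian_dist A g a y < r}"
    by blast
qed

lemma borel_measurable_riemannian_dist: "riemannian_dist A g a \<in> borel_measurable borel"
  by (rule borel_measurableI_less) (auto intro!: borel_open open_rball)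

end

theorem theorem3p3:
  fixes A :: "('g::{topological_group_add, second_countable_topology, t2_space}, 'n::finite) chart set"
    and g :: "('g, 'n) metric_tensor"
    and M :: "'g measure"
    and w :: "real \<Rightarrow> real"
    and f :: "'g \<Rightarrow> real"
    and p q :: ennreal
  assumes "lie_group A"
    and "connected (UNIV :: 'g set)"
    and "\<not> compact (UNIV :: 'g set)"
    and "riemannian_metric A g"
    and "left_invariant_metric A g"
    and "is_riemannian_volume A g M"
    and "radius_weight w"
    and "weight_G_norm A g M w < \<infinity>"
    and "f \<in> F_loc A g M"
    and "1 \<le> p" and "p \<le> q"
  shows "Lq_norm M q (I_op A g M p w f)
    \<le> epowr (weight_norm w) (weight_exponent p q)
      * epowr (weight_G_norm A g M w) (recip_exponent q)
      * Lq_norm M q (\<lambda>x. ennreal \<bar>f x\<bar>)"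
proof -
  interpret riemannian_lie_group_volume A g M
    by unfold_locales (fact assms)+
  obtain E where E: "haar_measure M E"
    using haar_measure_volume ..
  have "f \<in> borel_measurable M"
    using \<open>f \<in> F_loc A g M\<close> by (simp add: F_loc_def)
  then show ?thesis
    using \<open>radius_weight w\<close> \<open>1 \<le> p\<close> \<open>p \<le> q\<close>
    by (intro haar_measure.I_op_Lq_bound[OF E borel_measurable_riemannian_dist rball_eq])
qed

end
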